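(* Let $\mathfrak g$ be a Lie algebra over a field of characteristic $0$. Then $$H_2(F_{Lie}\,\mathfrak g[1],\mathbf d)=\Omega^0(\mathfrak g),$$ the identification being the canonical one induced by $F^2_{Lie}\,\mathfrak g[1]\ni(x,y)\mapsto x\otimes y$; here $H_2=\ker(\mathbf d:F^2_{Lie}\,\mathfrak g[1]\to\mathfrak g[1])/\mathrm{im}(\mathbf d:F^3_{Lie}\,\mathfrak g[1]\to F^2_{Lie}\,\mathfrak g[1])$ and $$\Omega^0(\mathfrak g)=\mathfrak g\otimes\mathfrak g/\langle x\otimes y-y\otimes x,\ [x,y]\otimes z-x\otimes[y,z]\ :\ x,y,z\in\mathfrak g\rangle.$$
   Context: $\mathfrak g[1]$ is $\mathfrak g$ placed in degree $-1$ (so its elements are odd), with the same bracket $[x,y]$ as $\mathfrak g$. $F_{Lie}\,\mathfrak g[1]=\bigoplus_{n\ge1}F^n_{Lie}\,\mathfrak g[1]$ is the free graded Lie algebra (Koszul signs) on $\mathfrak g[1]$, with bracket $(\cdot,\cdot)$ and $n$ the bracket length. For $x_i\in\mathfrak g[1]$ put $\{x_1,\dots,x_n\}:=(x_1,(x_2,(\dots,x_n)))$. The differential $\mathbf d$ is $0$ on $F^1_{Lie}\,\mathfrak g[1]=\mathfrak g[1]$, and for $n\ge1$, $\mathbf d:F^{n+1}_{Lie}\,\mathfrak g[1]\to F^n_{Lie}\,\mathfrak g[1]$ is the (well-defined) linear map with $$\mathbf d\{x_1,\dots,x_{n+1}\}=\sum_{i<j,\ i\le n}(-1)^{i-1}\{x_1,\dots,\widehat{x_i},\dots,[x_i,x_j],x_{j+1},\dots,x_{n+1}\}+(-1)^{n-1}\{x_1,\dots,x_{n-1},[x_{n+1},x_n]\},$$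 where $\widehat{x_i}$ means omission and $[x_i,x_j]$ replaces $x_j$. In particular $\mathbf d(x_1,x_2)=[x_1,x_2]+[x_2,x_1]$ and $\mathbf d(x_1,(x_2,x_3))=([x_1,x_2],x_3)+(x_2,[x_1,x_3])-(x_1,[x_2,x_3]+[x_3,x_2])$. *)

theory Defs
  imports Complex_Main "HOL-Library.Poly_Mapping"
begin

section \<open>Lie algebras over a field\<close>

locale lie_algebra = vector_space scale
  for scale :: "'k::field \<Rightarrow> 'g::ab_group_add \<Rightarrow> 'g" +
  fixes lbr :: "'g \<Rightarrow> 'g \<Rightarrow> 'g"
  assumes lbr_linear_left: "Vector_Spaces.linear scale scale (\<lambda>x. lbr x y)"
    and lbr_linear_right: "Vector_Spaces.linear scale scale (\<lambda>y. lbr x y)"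
    and lbr_alternating: "lbr x x = 0"
    and lbr_jacobi: "lbr x (lbr y z) + lbr y (lbr z x) + lbr z (lbr x y) = 0"


section \<open>Vector spaces with explicit carrier, and their quotients\<close>

text \<open>
  The spaces below are (iterated) quotients by subspaces that depend on the Lie algebra, so they
  cannot be types; they are carrier sets of cosets together with their linear structure.
\<close>

record ('k, 'v) vspace =
  vcarrier :: "'v set"
  vzero :: 'v
  vadd :: "'v \<Rightarrow> 'v \<Rightarrow> 'v"
  vscale :: "'k \<Rightarrow> 'v \<Rightarrow> 'v"

definition vdiff :: "('k::field, 'v) vspace \<Rightarrow> 'v \<Rightarrow> 'v \<Rightarrow> 'v" where
  "vdiff V u v = vadd V u (vscale V (- 1) v)"

definition vsum_list :: "('k, 'v) vspace \<Rightarrow> 'v list \<Rightarrow> 'v" where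
  "vsum_list V vs = foldr (vadd V) vs (vzero V)"

definition vsubspace :: "('k, 'v) vspace \<Rightarrow> 'v set \<Rightarrow> bool" where
  "vsubspace V U \<longleftrightarrow> U \<subseteq> vcarrier V \<and> vzero V \<in> U \<and>
     (\<forall>u\<in>U. \<forall>v\<in>U. vadd V u v \<in> U) \<and> (\<forall>c. \<forall>u\<in>U. vscale V c u \<in> U)"

definition vspan :: "('k, 'v) vspace \<Rightarrow> 'v set \<Rightarrow> 'v set" where
  "vspan V S = \<Inter>{U. vsubspace V U \<and> S \<subseteq> U}"

definition vrestrict :: "('k, 'v) vspace \<Rightarrow> 'v set \<Rightarrow> ('k, 'v) vspace" where
  "vrestrict V U = V\<lparr>vcarrier := U\<rparr>"

definition vlinear :: "('k, 'v) vspace \<Rightarrow> ('k, 'w) vspace \<Rightarrow> ('v \<Rightarrow> 'w) \<Rightarrow> bool" where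
  "vlinear V W f \<longleftrightarrow>
     (\<forall>u\<in>vcarrier V. f u \<in> vcarrier W) \<and>
     (\<forall>u\<in>vcarrier V. \<forall>v\<in>vcarrier V. f (vadd V u v) = vadd W (f u) (f v)) \<and>
     (\<forall>c. \<forall>u\<in>vcarrier V. f (vscale V c u) = vscale W c (f u))"

definition viso :: "('k, 'v) vspace \<Rightarrow> ('k, 'w) vspace \<Rightarrow> ('v \<Rightarrow> 'w) \<Rightarrow> bool" where
  "viso V W f \<longleftrightarrow> vlinear V W f \<and> bij_betw f (vcarrier V) (vcarrier W)"

definition vcoset :: "('k, 'v) vspace \<Rightarrow> 'v set \<Rightarrow> 'v \<Rightarrow> 'v set" where
  "vcoset V U v = {vadd V v u |u. u \<in> U}"

text \<open>In the scalar multiplication the summand from \<open>U\<close> is needed for the scalar \<open>0\<close>.\<close>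

definition vquot :: "('k, 'v) vspace \<Rightarrow> 'v set \<Rightarrow> ('k, 'v set) vspace" where
  "vquot V U = \<lparr>
     vcarrier = vcoset V U ` vcarrier V,
     vzero = U,
     vadd = (\<lambda>S T. {vadd V s t |s t. s \<in> S \<and> t \<in> T}),
     vscale = (\<lambda>c S. {vadd V (vscale V c s) u |s u. s \<in> S \<and> u \<in> U})\<rparr>"

definition free_vspace :: "('k::field, 'x \<Rightarrow>\<^sub>0 'k) vspace" where
  "free_vspace = \<lparr>vcarrier = UNIV, vzero = 0, vadd = (+),
     vscale = (\<lambda>c. Poly_Mapping.map ((*) c))\<rparr>"


section \<open>The free graded Lie algebra on \<open>\<gg>[1]\<close>\<close>

text \<open>
  Nonassociative monomials in elements of \<open>\<gg>\<close>. All generators have degree \<open>- 1\<close>, so a monomial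
  with \<open>n\<close> leaves has degree \<open>- n\<close> and parity \<open>n mod 2\<close>.
\<close>

datatype 'g mag = Gen 'g | Br "'g mag" "'g mag"

fun mag_len :: "'g mag \<Rightarrow> nat" where
  "mag_len (Gen x) = 1"
| "mag_len (Br s t) = mag_len s + mag_len t"

definition mag_mult :: "('g mag \<Rightarrow>\<^sub>0 'k::field) \<Rightarrow> ('g mag \<Rightarrow>\<^sub>0 'k) \<Rightarrow> ('g mag \<Rightarrow>\<^sub>0 'k)" where
  "mag_mult p q = (\<Sum>s\<in>Poly_Mapping.keys p. \<Sum>t\<in>Poly_Mapping.keys q.
     Poly_Mapping.single (Br s t) (Poly_Mapping.lookup p s * Poly_Mapping.lookup q t))"

text \<open>
  The two-sided ideal of the free nonassociative algebra generated by the linear structure of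
  \<open>\<gg>\<close>, graded antisymmetry \<open>(a, b) = - (- 1)\<^bsup>|a| |b|\<^esup> (b, a)\<close> and the graded Jacobi identity
  \<open>(a, (b, c)) = ((a, b), c) + (- 1)\<^bsup>|a| |b|\<^esup> (b, (a, c))\<close>. By multilinearity it suffices to
  impose the identities on monomials. In characteristic \<open>0\<close> these identities define graded
  Lie algebras; e.g. \<open>(a, (a, a)) = 0\<close> for odd \<open>a\<close> follows since \<open>3\<close> is invertible.
\<close>

inductive_set lie_ideal :: "('k::field \<Rightarrow> 'g::ab_group_add \<Rightarrow> 'g) \<Rightarrow> ('g mag \<Rightarrow>\<^sub>0 'k) set"
  for scale :: "'k \<Rightarrow> 'g \<Rightarrow> 'g" where
  gen_add: "Poly_Mapping.single (Gen (x + y)) 1 - Poly_Mapping.single (Gen x) 1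
      - Poly_Mapping.single (Gen y) 1 \<in> lie_ideal scale"
| gen_scale: "Poly_Mapping.single (Gen (scale c x)) 1 - Poly_Mapping.single (Gen x) c
      \<in> lie_ideal scale"
| antisym: "Poly_Mapping.single (Br a b) 1
      + Poly_Mapping.single (Br b a) ((- 1) ^ (mag_len a * mag_len b)) \<in> lie_ideal scale"
| jacobi: "Poly_Mapping.single (Br a (Br b c)) 1 - Poly_Mapping.single (Br (Br a b) c) 1
      - Poly_Mapping.single (Br b (Br a c)) ((- 1) ^ (mag_len a * mag_len b)) \<in> lie_ideal scale"
| zero: "0 \<in> lie_ideal scale"
| add: "p \<in> lie_ideal scale \<Longrightarrow> q \<in> lie_ideal scale \<Longrightarrow> p + q \<in> lie_ideal scale"
| smult: "p \<in> lie_ideal scale \<Longrightarrow> Poly_Mapping.map ((*) c) p \<in> lie_ideal scale"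
| mult_left: "p \<in> lie_ideal scale \<Longrightarrow> mag_mult q p \<in> lie_ideal scale"
| mult_right: "p \<in> lie_ideal scale \<Longrightarrow> mag_mult p q \<in> lie_ideal scale"

definition free_lie :: "('k::field \<Rightarrow> 'g::ab_group_add \<Rightarrow> 'g) \<Rightarrow> ('k, ('g mag \<Rightarrow>\<^sub>0 'k) set) vspace" where
  "free_lie scale = vquot free_vspace (lie_ideal scale)"

definition fl_gen :: "('k::field \<Rightarrow> 'g::ab_group_add \<Rightarrow> 'g) \<Rightarrow> 'g \<Rightarrow> ('g mag \<Rightarrow>\<^sub>0 'k) set" where
  "fl_gen scale x = vcoset free_vspace (lie_ideal scale) (Poly_Mapping.single (Gen x) 1)"

definition fl_br :: "('k::field \<Rightarrow> 'g::ab_group_add \<Rightarrow> 'g)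
    \<Rightarrow> ('g mag \<Rightarrow>\<^sub>0 'k) set \<Rightarrow> ('g mag \<Rightarrow>\<^sub>0 'k) set \<Rightarrow> ('g mag \<Rightarrow>\<^sub>0 'k) set" where
  "fl_br scale S T = {mag_mult p q + r |p q r. p \<in> S \<and> q \<in> T \<and> r \<in> lie_ideal scale}"

definition free_lie_deg ::
    "('k::field \<Rightarrow> 'g::ab_group_add \<Rightarrow> 'g) \<Rightarrow> nat \<Rightarrow> ('k, ('g mag \<Rightarrow>\<^sub>0 'k) set) vspace" where
  "free_lie_deg scale n = vrestrict (free_lie scale)
     (vcoset free_vspace (lie_ideal scale) ` {p. \<forall>t\<in>Poly_Mapping.keys p. mag_len t = n})"

text \<open>\<open>{x\<^sub>1, \<dots>, x\<^sub>n} = (x\<^sub>1, (x\<^sub>2, (\<dots>, x\<^sub>n)))\<close>; the value at the empty list is irrelevant.\<close>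

fun nest :: "('k::field \<Rightarrow> 'g::ab_group_add \<Rightarrow> 'g) \<Rightarrow> 'g list \<Rightarrow> ('g mag \<Rightarrow>\<^sub>0 'k) set" where
  "nest scale [] = vzero (free_lie scale)"
| "nest scale [x] = fl_gen scale x"
| "nest scale (x # y # xs) = fl_br scale (fl_gen scale x) (nest scale (y # xs))"


section \<open>The differential\<close>

text \<open>
  The right-hand side of the formula for \<open>d {x\<^sub>1, \<dots>, x\<^sub>n\<^sub>+\<^sub>1}\<close>. Indices \<open>i\<close>, \<open>j\<close> start at \<open>1\<close>, so
  \<open>x\<^sub>i\<close> is \<open>xs ! (i - 1)\<close>. \<open>contract_at\<close> replaces \<open>x\<^sub>j\<close> by \<open>[x\<^sub>i, x\<^sub>j]\<close> and then omits \<open>x\<^sub>i\<close>.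
\<close>

definition contract_at :: "('g \<Rightarrow> 'g \<Rightarrow> 'g) \<Rightarrow> nat \<Rightarrow> nat \<Rightarrow> 'g list \<Rightarrow> 'g list" where
  "contract_at lbr i j xs =
     (let ys = xs[j - 1 := lbr (xs ! (i - 1)) (xs ! (j - 1))] in take (i - 1) ys @ drop i ys)"

definition lie_diff_rhs :: "('k::field \<Rightarrow> 'g::ab_group_add \<Rightarrow> 'g) \<Rightarrow> ('g \<Rightarrow> 'g \<Rightarrow> 'g)
    \<Rightarrow> nat \<Rightarrow> 'g list \<Rightarrow> ('g mag \<Rightarrow>\<^sub>0 'k) set" where
  "lie_diff_rhs scale lbr n xs = vadd (free_lie scale)
     (vsum_list (free_lie scale)
       [vscale (free_lie scale) ((- 1) ^ (i - 1)) (nest scale (contract_at lbr i j xs)).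
         i \<leftarrow> [1..<n + 1], j \<leftarrow> [i + 1..<n + 2]])
     (vscale (free_lie scale) ((- 1) ^ (n - 1))
       (nest scale (take (n - 1) xs @ [lbr (xs ! n) (xs ! (n - 1))])))"

text \<open>
  \<open>lie_diff scale lbr m\<close> is the differential on \<open>F\<^sup>m\<close>. For \<open>m = n + 1 > 1\<close> it is the linear map
  \<open>F\<^bsup>n+1\<^esup> \<rightarrow> F\<^sup>n\<close> given by the formula; since the elements \<open>{x\<^sub>1, \<dots>, x\<^sub>n\<^sub>+\<^sub>1}\<close> span \<open>F\<^bsup>n+1\<^esup>\<close>, its values
  on \<open>F\<^bsup>n+1\<^esup>\<close> do not depend on the choice (values elsewhere are irrelevant).
\<close>

definition lie_diff :: "('k::field \<Rightarrow> 'g::ab_group_add \<Rightarrow> 'g) \<Rightarrow> ('g \<Rightarrow> 'g \<Rightarrow> 'g)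
    \<Rightarrow> nat \<Rightarrow> ('g mag \<Rightarrow>\<^sub>0 'k) set \<Rightarrow> ('g mag \<Rightarrow>\<^sub>0 'k) set" where
  "lie_diff scale lbr m =
     (if m \<le> 1 then (\<lambda>_. vzero (free_lie scale))
      else SOME D. vlinear (free_lie_deg scale m) (free_lie_deg scale (m - 1)) D \<and>
             (\<forall>xs. length xs = m \<longrightarrow> D (nest scale xs) = lie_diff_rhs scale lbr (m - 1) xs))"

definition lie_cycles :: "('k::field \<Rightarrow> 'g::ab_group_add \<Rightarrow> 'g) \<Rightarrow> ('g \<Rightarrow> 'g \<Rightarrow> 'g)
    \<Rightarrow> nat \<Rightarrow> ('g mag \<Rightarrow>\<^sub>0 'k) set set" where
  "lie_cycles scale lbr n =
     {u \<in> vcarrier (free_lie_deg scale n). lie_diff scale lbr n u = vzero (free_lie scale)}"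

definition lie_boundaries :: "('k::field \<Rightarrow> 'g::ab_group_add \<Rightarrow> 'g) \<Rightarrow> ('g \<Rightarrow> 'g \<Rightarrow> 'g)
    \<Rightarrow> nat \<Rightarrow> ('g mag \<Rightarrow>\<^sub>0 'k) set set" where
  "lie_boundaries scale lbr n =
     lie_diff scale lbr (n + 1) ` vcarrier (free_lie_deg scale (n + 1))"

definition lie_homology :: "('k::field \<Rightarrow> 'g::ab_group_add \<Rightarrow> 'g) \<Rightarrow> ('g \<Rightarrow> 'g \<Rightarrow> 'g)
    \<Rightarrow> nat \<Rightarrow> ('k, ('g mag \<Rightarrow>\<^sub>0 'k) set set) vspace" where
  "lie_homology scale lbr n =
     vquot (vrestrict (free_lie scale) (lie_cycles scale lbr n)) (lie_boundaries scale lbr n)"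

definition homology_class :: "('k::field \<Rightarrow> 'g::ab_group_add \<Rightarrow> 'g) \<Rightarrow> ('g \<Rightarrow> 'g \<Rightarrow> 'g)
    \<Rightarrow> nat \<Rightarrow> ('g mag \<Rightarrow>\<^sub>0 'k) set \<Rightarrow> ('g mag \<Rightarrow>\<^sub>0 'k) set set" where
  "homology_class scale lbr n u =
     vcoset (vrestrict (free_lie scale) (lie_cycles scale lbr n)) (lie_boundaries scale lbr n) u"


section \<open>The tensor square and \<open>\<Omega>\<^sup>0(\<gg>)\<close>\<close>

definition tensor_rel :: "('k::field \<Rightarrow> 'g::ab_group_add \<Rightarrow> 'g) \<Rightarrow> ('g \<times> 'g \<Rightarrow>\<^sub>0 'k) set" where
  "tensor_rel scale = vspan free_vspace
     ({Poly_Mapping.single (x + x', y) 1 - Poly_Mapping.single (x, y) 1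
         - Poly_Mapping.single (x', y) 1 |x x' y. True} \<union>
      {Poly_Mapping.single (x, y + y') 1 - Poly_Mapping.single (x, y) 1
         - Poly_Mapping.single (x, y') 1 |x y y'. True} \<union>
      {Poly_Mapping.single (scale c x, y) 1 - Poly_Mapping.single (x, y) c |c x y. True} \<union>
      {Poly_Mapping.single (x, scale c y) 1 - Poly_Mapping.single (x, y) c |c x y. True})"

definition tensor_square ::
    "('k::field \<Rightarrow> 'g::ab_group_add \<Rightarrow> 'g) \<Rightarrow> ('k, ('g \<times> 'g \<Rightarrow>\<^sub>0 'k) set) vspace" where
  "tensor_square scale = vquot free_vspace (tensor_rel scale)"

definition tensor :: "('k::field \<Rightarrow> 'g::ab_group_add \<Rightarrow> 'g) \<Rightarrow> 'g \<Rightarrow> 'g \<Rightarrow> ('g \<times> 'g \<Rightarrow>\<^sub>0 'k) set" where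
  "tensor scale x y = vcoset free_vspace (tensor_rel scale) (Poly_Mapping.single (x, y) 1)"

definition Omega0_rel :: "('k::field \<Rightarrow> 'g::ab_group_add \<Rightarrow> 'g) \<Rightarrow> ('g \<Rightarrow> 'g \<Rightarrow> 'g)
    \<Rightarrow> ('g \<times> 'g \<Rightarrow>\<^sub>0 'k) set set" where
  "Omega0_rel scale lbr = vspan (tensor_square scale)
     ({vdiff (tensor_square scale) (tensor scale x y) (tensor scale y x) |x y. True} \<union>
      {vdiff (tensor_square scale) (tensor scale (lbr x y) z) (tensor scale x (lbr y z))
        |x y z. True})"

definition Omega0 :: "('k::field \<Rightarrow> 'g::ab_group_add \<Rightarrow> 'g) \<Rightarrow> ('g \<Rightarrow> 'g \<Rightarrow> 'g)
    \<Rightarrow> ('k, ('g \<times> 'g \<Rightarrow>\<^sub>0 'k) set set) vspace" where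
  "Omega0 scale lbr = vquot (tensor_square scale) (Omega0_rel scale lbr)"

definition Omega0_class :: "('k::field \<Rightarrow> 'g::ab_group_add \<Rightarrow> 'g) \<Rightarrow> ('g \<Rightarrow> 'g \<Rightarrow> 'g)
    \<Rightarrow> ('g \<times> 'g \<Rightarrow>\<^sub>0 'k) set \<Rightarrow> ('g \<times> 'g \<Rightarrow>\<^sub>0 'k) set set" where
  "Omega0_class scale lbr t = vcoset (tensor_square scale) (Omega0_rel scale lbr) t"

end

(*
  (x, y) is symmetric in odd generators, so F^2 is the symmetric square of g, and d vanishes on it.
  On F^3 the last two summands of the formula cancel, d (x, (y, z)) = ([x, y], z) + (y, [x, z]),
  which is minus the relation [y, x] z - y [x, z] of Omega^0. Hence both sides are the quotient of
  g tensor g by the same relations.  The formula defines a map on F^3 because it respects graded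
  antisymmetry and the Jacobi identity of three generators modulo symmetric tensors.
*)
theory Submission
  imports Defs
begin

section \<open>Linear extension\<close>

text \<open>\<open>lie_diff\<close> is picked by \<open>SOME\<close>, so nothing is known about it
  until a linear map with the prescribed values on nested brackets has been constructed; this is
  where well-definedness of the differential has to be proved. All spaces consist of cosets, partly
  cosets of cosets, so every map is first written on formal sums of trees or pairs and then shown to
  respect the relations. The obstacle is \<open>lie_ideal\<close>: it is not presented degree by
  degree and is closed under products with arbitrary formal sums of trees. The maps
  \<open>lin1\<close>, \<open>quad\<close> and \<open>cubic\<close> are therefore defined on all
  trees and studied together, because the cubic part of a product depends on the linear and
  quadratic parts of its factors. Tensors are formal sums of pairs, where \<open>tens 0 y\<close> is
  a relation and not 0; hence most identities for \<open>quad\<close> and \<open>cubic\<close> are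
  memberships in \<open>trel\<close> or \<open>srel\<close> rather than equations. The minus sign in
  \<open>cubic\<close> is forced by graded antisymmetry: for lengths 2 and 1 the sign exponent is
  even, so ((y, z), x) = -(x, (y, z)).\<close>

abbreviation pm_scale :: "'k::field \<Rightarrow> ('a \<Rightarrow>\<^sub>0 'k) \<Rightarrow> ('a \<Rightarrow>\<^sub>0 'k)" (infixr "\<odot>" 75) where
  "c \<odot> p \<equiv> Poly_Mapping.map ((*) c) p"

lemma lookup_pm_scale [simp]: "Poly_Mapping.lookup (c \<odot> p) t = c * Poly_Mapping.lookup p t"
  by (simp add: Poly_Mapping.map.rep_eq when_def)

interpretation pm: vector_space "pm_scale :: 'k::field \<Rightarrow> ('a \<Rightarrow>\<^sub>0 'k) \<Rightarrow> _"
  by unfold_locales (auto intro!: poly_mapping_eqI simp: lookup_add algebra_simps)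

lemma pm_scale_single [simp]: "c \<odot> Poly_Mapping.single t d = Poly_Mapping.single t (c * d)"
  by (rule poly_mapping_eqI) (simp add: lookup_single when_def)

lemma pm_expand:
  fixes p :: "'a \<Rightarrow>\<^sub>0 'k::field"
  shows "p = (\<Sum>t\<in>Poly_Mapping.keys p. Poly_Mapping.lookup p t \<odot> Poly_Mapping.single t 1)"
  by (rule poly_mapping_eqI)
    (auto simp: lookup_sum lookup_single when_def sum.delta' in_keys_iff if_distrib cong: if_cong)

lemma pm_in_subspace:
  assumes "pm.subspace U" "\<And>t. t \<in> Poly_Mapping.keys p \<Longrightarrow> Poly_Mapping.single t 1 \<in> U"
  shows "p \<in> U"
proof -
  have "(\<Sum>t\<in>Poly_Mapping.keys p. Poly_Mapping.lookup p t \<odot> Poly_Mapping.single t 1) \<in> U"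
    using assms by (intro pm.subspace_sum pm.subspace_scale) auto
  then show ?thesis by (simp only: pm_expand[symmetric])
qed

text \<open>The scalar action is an argument because the target is g itself for \<open>lin\<close>
  and a space of formal sums for \<open>plext\<close>.\<close>

definition lext :: "('k::field \<Rightarrow> 'v \<Rightarrow> 'v) \<Rightarrow> ('a \<Rightarrow> 'v) \<Rightarrow> ('a \<Rightarrow>\<^sub>0 'k) \<Rightarrow> 'v::ab_group_add" where
  "lext sc \<phi> p = (\<Sum>t\<in>Poly_Mapping.keys p. sc (Poly_Mapping.lookup p t) (\<phi> t))"

context vector_space begin

text \<open>Keys may disappear under addition and scaling; a common finite index set makes the sums
  comparable.\<close>

lemma lext_superset:
  assumes "finite A" "Poly_Mapping.keys p \<subseteq> A"
  shows "lext scale \<phi> p = (\<Sum>t\<in>A. scale (Poly_Mapping.lookup p t) (\<phi> t))"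
  unfolding lext_def using assms
  by (intro sum.mono_neutral_left) (auto simp: in_keys_iff)

lemma lext_add [simp]: "lext scale \<phi> (p + q) = lext scale \<phi> p + lext scale \<phi> q"
proof -
  let ?A = "Poly_Mapping.keys p \<union> Poly_Mapping.keys q"
  have "Poly_Mapping.keys (p + q) \<subseteq> ?A" by (rule keys_add)
  then show ?thesis
    by (subst (1 2 3) lext_superset[where A = ?A])
      (auto simp: lookup_add scale_left_distrib sum.distrib)
qed

lemma lext_scale [simp]: "lext scale \<phi> (c \<odot> p) = scale c (lext scale \<phi> p)"
  by (subst (1 2) lext_superset[where A = "Poly_Mapping.keys p"])
    (auto simp: in_keys_iff scale_sum_right)

lemma lext_zero [simp]: "lext scale \<phi> 0 = 0"
  by (simp add: lext_def)

lemma lext_single [simp]: "lext scale \<phi> (Poly_Mapping.single t c) = scale c (\<phi> t)"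
  by (subst lext_superset[where A = "{t}"]) auto

lemma lext_minus [simp]: "lext scale \<phi> (- p) = - lext scale \<phi> p"
  using lext_add[of \<phi> p "- p"] by (simp add: eq_neg_iff_add_eq_0 add.commute)

lemma lext_diff [simp]: "lext scale \<phi> (p - q) = lext scale \<phi> p - lext scale \<phi> q"
  using lext_add[of \<phi> p "- q"] by simp

lemma lext_sum: "lext scale \<phi> (\<Sum>i\<in>A. g i) = (\<Sum>i\<in>A. lext scale \<phi> (g i))"
  by (induction A rule: infinite_finite_induct) auto

lemma lext_mem:
  assumes "subspace U" "\<And>t. t \<in> Poly_Mapping.keys p \<Longrightarrow> \<phi> t \<in> U"
  shows "lext scale \<phi> p \<in> U"
  unfolding lext_def using assms by (intro subspace_sum subspace_scale) auto

lemma lext_scale_fun: "lext scale (\<lambda>t. scale c (\<phi> t)) p = scale c (lext scale \<phi> p)"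
  by (simp add: lext_def scale_sum_right mult.commute)

lemma lext_diff_fun: "lext scale (\<lambda>t. \<phi> t - \<psi> t) p = lext scale \<phi> p - lext scale \<psi> p"
  by (simp add: lext_def scale_right_diff_distrib sum_subtractf)

lemma subspace_lext_vimage: "subspace U \<Longrightarrow> pm.subspace {p. lext scale \<phi> p \<in> U}"
  unfolding pm.subspace_def by (auto intro: subspace_add subspace_scale subspace_0)

end

lemma lext_cong: "(\<And>t. t \<in> Poly_Mapping.keys p \<Longrightarrow> \<phi> t = \<psi> t) \<Longrightarrow> lext sc \<phi> p = lext sc \<psi> p"
  by (simp add: lext_def)

abbreviation plext :: "('a \<Rightarrow> ('b \<Rightarrow>\<^sub>0 'k)) \<Rightarrow> ('a \<Rightarrow>\<^sub>0 'k) \<Rightarrow> ('b \<Rightarrow>\<^sub>0 'k::field)" where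
  "plext \<equiv> lext pm_scale"

lemma plext_single_id [simp]: "plext (\<lambda>t. Poly_Mapping.single t 1) p = p"
  unfolding lext_def by (rule pm_expand[symmetric])

lemma plext_span:
  assumes "\<And>s. s \<in> S \<Longrightarrow> plext \<phi> s \<in> U" "pm.subspace U" "p \<in> pm.span S"
  shows "plext \<phi> p \<in> U"
proof -
  have "pm.span S \<subseteq> {p. plext \<phi> p \<in> U}"
    using assms by (intro pm.span_minimal pm.subspace_lext_vimage) auto
  then show ?thesis using assms(3) by blast
qed

section \<open>Presentations of vector spaces with explicit carrier\<close>

text \<open>\<open>V\<close> is identified with the quotient A/K of a space of formal sums, \<pi>
  being the quotient map; \<pi> is constrained on \<open>A\<close> only. This keeps coset arithmetic
  out of everything that follows.\<close>

locale presentation =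
  fixes V :: "('k::field, 'v) vspace" and \<pi> :: "('a \<Rightarrow>\<^sub>0 'k) \<Rightarrow> 'v" and A K :: "('a \<Rightarrow>\<^sub>0 'k) set"
  assumes sub_A: "pm.subspace A" and sub_K: "pm.subspace K" and K_A: "K \<subseteq> A"
    and carrier_eq: "vcarrier V = \<pi> ` A"
    and zero_eq: "vzero V = \<pi> 0"
    and add_eq: "\<And>p q. p \<in> A \<Longrightarrow> q \<in> A \<Longrightarrow> vadd V (\<pi> p) (\<pi> q) = \<pi> (p + q)"
    and scale_eq: "\<And>c p. p \<in> A \<Longrightarrow> vscale V c (\<pi> p) = \<pi> (c \<odot> p)"
    and eq_iff: "\<And>p q. p \<in> A \<Longrightarrow> q \<in> A \<Longrightarrow> \<pi> p = \<pi> q \<longleftrightarrow> p - q \<in> K"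
begin

lemma vcoset_eq:
  assumes "B \<subseteq> A" "p \<in> A"
  shows "vcoset V (\<pi> ` B) (\<pi> p) = {\<pi> (p + u) |u. u \<in> B}"
proof -
  have "\<And>u. u \<in> B \<Longrightarrow> vadd V (\<pi> p) (\<pi> u) = \<pi> (p + u)"
    using assms add_eq by blast
  then show ?thesis unfolding vcoset_def by force
qed

text \<open>Third isomorphism theorem: (A/K)/(B/K) is A/B. It turns cosets of cosets into a single
  quotient of formal sums.\<close>

lemma presentation_vquot:
  assumes B: "pm.subspace B" and KB: "K \<subseteq> B" and BA: "B \<subseteq> A"
  shows "presentation (vquot V (\<pi> ` B)) (\<lambda>p. vcoset V (\<pi> ` B) (\<pi> p)) A B"
proof
  note cos = vcoset_eq[OF BA]
  have AD: "\<And>p q. p \<in> A \<Longrightarrow> q \<in> A \<Longrightarrow> p + q \<in> A" using sub_A by (rule pm.subspace_add)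
  have BD: "\<And>p q. p \<in> B \<Longrightarrow> q \<in> B \<Longrightarrow> p + q \<in> B" using B by (rule pm.subspace_add)
  show "vcarrier (vquot V (\<pi> ` B)) = (\<lambda>p. vcoset V (\<pi> ` B) (\<pi> p)) ` A"
    by (auto simp: vquot_def carrier_eq)
  show "vzero (vquot V (\<pi> ` B)) = vcoset V (\<pi> ` B) (\<pi> 0)"
    by (auto simp: vquot_def cos pm.subspace_0[OF sub_A])
  show "vadd (vquot V (\<pi> ` B)) (vcoset V (\<pi> ` B) (\<pi> p)) (vcoset V (\<pi> ` B) (\<pi> q))
      = vcoset V (\<pi> ` B) (\<pi> (p + q))" if "p \<in> A" "q \<in> A" for p q
  proof -
    have *: "vadd V (\<pi> (p + u)) (\<pi> (q + u')) = \<pi> (p + q + (u + u'))" if "u \<in> B" "u' \<in> B" for u u'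
      using that \<open>p \<in> A\<close> \<open>q \<in> A\<close> BA by (subst add_eq) (auto intro: AD simp: algebra_simps)
    show ?thesis
    proof (intro set_eqI iffI)
      fix z assume "z \<in> vadd (vquot V (\<pi> ` B)) (vcoset V (\<pi> ` B) (\<pi> p)) (vcoset V (\<pi> ` B) (\<pi> q))"
      then show "z \<in> vcoset V (\<pi> ` B) (\<pi> (p + q))"
        using that by (auto simp: vquot_def cos AD *) (use BD in blast)
    next
      fix z assume "z \<in> vcoset V (\<pi> ` B) (\<pi> (p + q))"
      then obtain u where u: "u \<in> B" "z = \<pi> (p + q + (u + 0))"
        using cos[OF AD] \<open>p \<in> A\<close> \<open>q \<in> A\<close> by auto
      then have "z = vadd V (\<pi> (p + u)) (\<pi> (q + 0))"
        using *[of u 0] pm.subspace_0[OF B] by simp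
      moreover have "\<pi> (p + u) \<in> vcoset V (\<pi> ` B) (\<pi> p)" "\<pi> (q + 0) \<in> vcoset V (\<pi> ` B) (\<pi> q)"
        unfolding cos[OF \<open>p \<in> A\<close>] cos[OF \<open>q \<in> A\<close>] using u pm.subspace_0[OF B] by blast+
      ultimately show "z \<in> vadd (vquot V (\<pi> ` B)) (vcoset V (\<pi> ` B) (\<pi> p)) (vcoset V (\<pi> ` B) (\<pi> q))"
        unfolding vquot_def vspace.simps by blast
    qed
  qed
  show "vscale (vquot V (\<pi> ` B)) c (vcoset V (\<pi> ` B) (\<pi> p)) = vcoset V (\<pi> ` B) (\<pi> (c \<odot> p))"
    if "p \<in> A" for c p
  proof -
    have AS: "\<And>p. p \<in> A \<Longrightarrow> c \<odot> p \<in> A" using sub_A by (rule pm.subspace_scale)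
    have BS: "\<And>p. p \<in> B \<Longrightarrow> c \<odot> p \<in> B" using B by (rule pm.subspace_scale)
    have *: "vadd V (vscale V c (\<pi> (p + u))) (\<pi> u') = \<pi> (c \<odot> p + (c \<odot> u + u'))"
      if "u \<in> B" "u' \<in> B" for u u'
      using that \<open>p \<in> A\<close> BA
      by (subst scale_eq, force intro: AD, subst add_eq)
        (auto intro!: AD AS simp: algebra_simps pm.scale_right_distrib)
    show ?thesis
    proof (intro set_eqI iffI)
      fix z assume "z \<in> vscale (vquot V (\<pi> ` B)) c (vcoset V (\<pi> ` B) (\<pi> p))"
      then show "z \<in> vcoset V (\<pi> ` B) (\<pi> (c \<odot> p))"
        using that by (auto simp: vquot_def cos AS *) (use BD BS in blast)
    next
      fix z assume "z \<in> vcoset V (\<pi> ` B) (\<pi> (c \<odot> p))"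
      \<comment> \<open>All of \<open>u\<close> goes into the added summand, because for c = 0 the
        scaled summand contributes nothing.\<close>
      then obtain u where u: "u \<in> B" "z = \<pi> (c \<odot> p + (c \<odot> 0 + u))"
        using cos[OF AS] \<open>p \<in> A\<close> by auto
      then have "z = vadd V (vscale V c (\<pi> (p + 0))) (\<pi> u)"
        using *[of 0 u] pm.subspace_0[OF B] by simp
      moreover have "\<pi> (p + 0) \<in> vcoset V (\<pi> ` B) (\<pi> p)"
        unfolding cos[OF \<open>p \<in> A\<close>] using pm.subspace_0[OF B] by blast
      ultimately show "z \<in> vscale (vquot V (\<pi> ` B)) c (vcoset V (\<pi> ` B) (\<pi> p))"
        using u(1) unfolding vquot_def vspace.simps by blast
    qed
  qed
  show "vcoset V (\<pi> ` B) (\<pi> p) = vcoset V (\<pi> ` B) (\<pi> q) \<longleftrightarrow> p - q \<in> B" if pq: "p \<in> A" "q \<in> A" for p q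
  proof
    assume "vcoset V (\<pi> ` B) (\<pi> p) = vcoset V (\<pi> ` B) (\<pi> q)"
    moreover have "\<pi> (p + 0) \<in> vcoset V (\<pi> ` B) (\<pi> p)"
      unfolding cos[OF pq(1)] using pm.subspace_0[OF B] by blast
    ultimately obtain u where u: "u \<in> B" "\<pi> p = \<pi> (q + u)" using pq by (auto simp: cos)
    then have "p - (q + u) \<in> K" using eq_iff[of p "q + u"] pq BA AD by blast
    then have "(p - (q + u)) + u \<in> B" using KB u BD by blast
    then show "p - q \<in> B" by simp
  next
    assume d: "p - q \<in> B"
    show "vcoset V (\<pi> ` B) (\<pi> p) = vcoset V (\<pi> ` B) (\<pi> q)"
      unfolding cos[OF pq(1)] cos[OF pq(2)]
    proof (intro set_eqI iffI; clarify)
      fix u assume "u \<in> B"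
      then show "\<exists>u'. \<pi> (p + u) = \<pi> (q + u') \<and> u' \<in> B"
        by (intro exI[of _ "(p - q) + u"]) (auto intro: BD d)
    next
      fix u assume "u \<in> B"
      then show "\<exists>u'. \<pi> (q + u) = \<pi> (p + u') \<and> u' \<in> B"
        using pm.subspace_diff[OF B _ d, of u]
        by (intro exI[of _ "u - (p - q)"]) (simp add: algebra_simps)
    qed
  qed
qed (use assms sub_A in auto)

lemma presentation_vrestrict:
  assumes "pm.subspace B" "B \<subseteq> A"
  shows "presentation (vrestrict V (\<pi> ` B)) \<pi> B (K \<inter> B)"
proof
  show "pm.subspace (K \<inter> B)" using sub_K assms(1) by (rule pm.subspace_inter)
qed (use assms in \<open>auto simp: vrestrict_def zero_eq intro!: add_eq scale_eq,
      auto dest: eq_iff[THEN iffD1, rotated 2] pm.subspace_diff[OF assms(1)] intro: eq_iff[THEN iffD2]\<close>)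

text \<open>Adding \<open>K\<close> to the generators does not change the image, but yields a
  subspace containing \<open>K\<close>, as \<open>presentation_vquot\<close> requires.\<close>

lemma vspan_eq:
  assumes "A = UNIV"
  shows "vspan V (\<pi> ` T) = \<pi> ` pm.span (T \<union> K)"
proof
  have "vsubspace V (\<pi> ` pm.span (T \<union> K))"
    unfolding vsubspace_def using assms
    by (auto simp: carrier_eq zero_eq add_eq scale_eq intro!: imageI pm.span_zero pm.span_add pm.span_scale)
  then show "vspan V (\<pi> ` T) \<subseteq> \<pi> ` pm.span (T \<union> K)"
    unfolding vspan_def by (intro Inter_lower) (auto intro: pm.span_base)
  show "\<pi> ` pm.span (T \<union> K) \<subseteq> vspan V (\<pi> ` T)"
    unfolding vspan_def
  proof (intro Inter_greatest)
    fix U assume "U \<in> {U. vsubspace V U \<and> \<pi> ` T \<subseteq> U}"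
    then have U: "vsubspace V U" "\<pi> ` T \<subseteq> U" by auto
    have "pm.subspace {p. \<pi> p \<in> U}"
      using U(1) assms add_eq scale_eq zero_eq unfolding pm.subspace_def vsubspace_def
      by (metis UNIV_I mem_Collect_eq)
    moreover have "\<pi> k \<in> U" if "k \<in> K" for k
    proof -
      have "\<pi> k = \<pi> 0" using eq_iff[of k 0] that assms by simp
      then show ?thesis using U(1) unfolding vsubspace_def zero_eq by simp
    qed
    ultimately have "pm.span (T \<union> K) \<subseteq> {p. \<pi> p \<in> U}"
      using U(2) by (intro pm.span_minimal) auto
    then show "\<pi> ` pm.span (T \<union> K) \<subseteq> U" by blast
  qed
qed

lemma vlinear_lift:
  assumes W: "presentation W \<rho> A' K'"
    and A: "\<And>p. p \<in> A \<Longrightarrow> plext \<phi> p \<in> A'" and K: "\<And>p. p \<in> K \<Longrightarrow> plext \<phi> p \<in> K'"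
  obtains F where "vlinear V W F" "\<And>p. p \<in> A \<Longrightarrow> F (\<pi> p) = \<rho> (plext \<phi> p)"
proof -
  interpret W: presentation W \<rho> A' K' by (rule W)
  \<comment> \<open>Any representative will do: two of them differ by an element of
    \<open>K\<close>, which \<open>plext\<close> sends into \<open>K'\<close>.\<close>
  define F where "F v = \<rho> (plext \<phi> (SOME p. p \<in> A \<and> \<pi> p = v))" for v
  have F: "F (\<pi> p) = \<rho> (plext \<phi> p)" if "p \<in> A" for p
  proof -
    define q where "q = (SOME q. q \<in> A \<and> \<pi> q = \<pi> p)"
    have q: "q \<in> A \<and> \<pi> q = \<pi> p" unfolding q_def by (rule someI[of _ p]) (use that in simp)
    then have "q - p \<in> K" using eq_iff that by blast
    then have "plext \<phi> q - plext \<phi> p \<in> K'" using K[of "q - p"] by simp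
    then show ?thesis using W.eq_iff[OF A A] q that unfolding F_def q_def by blast
  qed
  moreover have "vlinear V W F"
    unfolding vlinear_def carrier_eq W.carrier_eq
    by (auto simp: F A add_eq scale_eq W.add_eq W.scale_eq pm.subspace_add[OF sub_A] pm.subspace_scale[OF sub_A])
  ultimately show ?thesis using that by blast
qed

text \<open>The two directions of the equivalence give well-definedness and injectivity of the
  induced map.\<close>

lemma viso_lift:
  assumes W: "presentation W \<rho> A' K'"
    and A: "\<And>p. p \<in> A \<Longrightarrow> plext \<phi> p \<in> A'" and K: "\<And>p. p \<in> A \<Longrightarrow> plext \<phi> p \<in> K' \<longleftrightarrow> p \<in> K"
    and surj: "\<And>q. q \<in> A' \<Longrightarrow> \<exists>p\<in>A. plext \<phi> p = q"
  obtains F where "viso V W F" "\<And>p. p \<in> A \<Longrightarrow> F (\<pi> p) = \<rho> (plext \<phi> p)"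
proof -
  interpret W: presentation W \<rho> A' K' by (rule W)
  obtain F where F: "vlinear V W F" "\<And>p. p \<in> A \<Longrightarrow> F (\<pi> p) = \<rho> (plext \<phi> p)"
    using vlinear_lift[OF W A] K K_A by (metis subsetD)
  have "inj_on F (vcarrier V)"
    unfolding carrier_eq
  proof (rule inj_onI; clarify)
    fix p q assume *: "p \<in> A" "q \<in> A" "F (\<pi> p) = F (\<pi> q)"
    then have "plext \<phi> (p - q) \<in> K'" using F(2) W.eq_iff A by simp
    then show "\<pi> p = \<pi> q" using K eq_iff * pm.subspace_diff[OF sub_A] by blast
  qed
  moreover have "F ` vcarrier V = vcarrier W"
    unfolding carrier_eq W.carrier_eq image_image using F(2) A surj by (force simp: image_iff)
  ultimately show ?thesis using F that unfolding viso_def bij_betw_def by blast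
qed

end

lemma presentation_free_vspace: "presentation free_vspace (\<lambda>p. p) UNIV {0}"
  by unfold_locales (auto simp: free_vspace_def pm.subspace_def)

section \<open>The free nonassociative algebra\<close>

text \<open>Bilinearity is demanded only modulo \<open>U\<close>, since the lemma is applied to
  expressions such as \<open>tens (lin p) (lin q)\<close>, which are bilinear only modulo
  \<open>trel\<close>.\<close>

lemma bilinear_mem:
  fixes G :: "('a \<Rightarrow>\<^sub>0 'k::field) \<Rightarrow> ('b \<Rightarrow>\<^sub>0 'k) \<Rightarrow> ('c \<Rightarrow>\<^sub>0 'k)"
  assumes U: "pm.subspace U"
    and add_left: "\<And>p p' q. G (p + p') q - G p q - G p' q \<in> U"
    and scale_left: "\<And>c p q. G (c \<odot> p) q - c \<odot> G p q \<in> U"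
    and add_right: "\<And>p q q'. G p (q + q') - G p q - G p q' \<in> U"
    and scale_right: "\<And>c p q. G p (c \<odot> q) - c \<odot> G p q \<in> U"
    and single: "\<And>s t. G (Poly_Mapping.single s 1) (Poly_Mapping.single t 1) \<in> U"
  shows "G p q \<in> U"
proof -
  have closed: "pm.subspace {p. g p \<in> U}"
    if g: "\<And>p p'. g (p + p') - g p - g p' \<in> U" "\<And>c p. g (c \<odot> p) - c \<odot> g p \<in> U"
    for g :: "('d \<Rightarrow>\<^sub>0 'k) \<Rightarrow> ('c \<Rightarrow>\<^sub>0 'k)"
  proof (rule pm.subspaceI; clarsimp)
    show "g 0 \<in> U" using g(2)[of 0 0] by simp
    show "g (p + p') \<in> U" if "g p \<in> U" "g p' \<in> U" for p p'
      using pm.subspace_add[OF U g(1)[of p p'] pm.subspace_add[OF U that]] by simp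
    show "g (c \<odot> p) \<in> U" if "g p \<in> U" for c p
      using pm.subspace_add[OF U g(2)[of c p] pm.subspace_scale[OF U that, of c]] by simp
  qed
  have "G (Poly_Mapping.single s 1) q \<in> U" for s
    using pm_in_subspace[OF closed[of "G (Poly_Mapping.single s 1)", OF add_right scale_right]] single
    by blast
  then show ?thesis
    using pm_in_subspace[OF closed[of "\<lambda>p. G p q", OF add_left scale_left]] by blast
qed

lemma plext_plext: "plext \<phi> (plext \<psi> p) = plext (\<lambda>t. plext \<phi> (\<psi> t)) p"
  by (simp add: lext_def[of _ \<psi>] lext_def[of _ "\<lambda>t. plext \<phi> (\<psi> t)"] pm.lext_sum)

lemma mag_mult_lext:
  "mag_mult p q = plext (\<lambda>s. plext (\<lambda>t. Poly_Mapping.single (Br s t) 1) q) p"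
  by (simp add: mag_mult_def lext_def pm.scale_sum_right)

lemma mag_mult_lext':
  "mag_mult p q = plext (\<lambda>t. plext (\<lambda>s. Poly_Mapping.single (Br s t) 1) p) q"
  unfolding mag_mult_def
  by (subst sum.swap) (simp add: lext_def pm.scale_sum_right mult.commute)

lemma mag_mult_add_left: "mag_mult (p + p') q = mag_mult p q + mag_mult p' q"
  and mag_mult_diff_left: "mag_mult (p - p') q = mag_mult p q - mag_mult p' q"
  and mag_mult_scale_left: "mag_mult (c \<odot> p) q = c \<odot> mag_mult p q"
  by (simp_all only: mag_mult_lext pm.lext_add pm.lext_diff pm.lext_scale)

lemma mag_mult_add_right: "mag_mult p (q + q') = mag_mult p q + mag_mult p q'"
  and mag_mult_diff_right: "mag_mult p (q - q') = mag_mult p q - mag_mult p q'"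
  and mag_mult_scale_right: "mag_mult p (c \<odot> q) = c \<odot> mag_mult p q"
  by (simp_all only: mag_mult_lext' pm.lext_add pm.lext_diff pm.lext_scale)

lemma mag_mult_single [simp]:
  "mag_mult (Poly_Mapping.single s c) (Poly_Mapping.single t d) = Poly_Mapping.single (Br s t) (c * d)"
  by (simp add: mag_mult_lext)

lemma mag_len_pos [simp]: "0 < mag_len t"
  by (induction t) auto

lemma mag_len_eq_1: "mag_len t = Suc 0 \<longleftrightarrow> (\<exists>x. t = Gen x)"
proof (cases t)
  case (Br s u)
  have "mag_len s + mag_len u \<noteq> Suc 0"
    using mag_len_pos[of s] mag_len_pos[of u] by linarith
  then show ?thesis using Br by auto
qed auto

lemma mag_len_eq_2: "mag_len t = 2 \<longleftrightarrow> (\<exists>x y. t = Br (Gen x) (Gen y))"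
proof (cases t)
  case (Br s u)
  have "mag_len s + mag_len u = 2 \<longleftrightarrow> mag_len s = Suc 0 \<and> mag_len u = Suc 0"
    using mag_len_pos[of s] mag_len_pos[of u] by linarith
  then show ?thesis using Br by (auto simp: mag_len_eq_1)
qed auto

lemma mag_len_eq_3: "mag_len t = 3 \<longleftrightarrow>
  (\<exists>x y z. t = Br (Gen x) (Br (Gen y) (Gen z)) \<or> t = Br (Br (Gen y) (Gen z)) (Gen x))"
proof (cases t)
  case (Br s u)
  have "mag_len s + mag_len u = 3 \<longleftrightarrow>
      mag_len s = Suc 0 \<and> mag_len u = 2 \<or> mag_len s = 2 \<and> mag_len u = Suc 0"
    using mag_len_pos[of s] mag_len_pos[of u] by linarith
  then show ?thesis using Br by (auto simp: mag_len_eq_1 mag_len_eq_2)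
qed auto

lemma subspace_lie_ideal: "pm.subspace (lie_ideal scale)"
  unfolding pm.subspace_def by (auto intro: lie_ideal.intros)

definition mag_deg :: "nat \<Rightarrow> ('g mag \<Rightarrow>\<^sub>0 'k::field) set" where
  "mag_deg n = {p. \<forall>t\<in>Poly_Mapping.keys p. mag_len t = n}"

lemma subspace_mag_deg: "pm.subspace (mag_deg n)"
  unfolding pm.subspace_def mag_deg_def
  by (auto simp: in_keys_iff lookup_add)

lemma mag_deg_induct:
  assumes "p \<in> mag_deg n" "pm.subspace U" "\<And>t. mag_len t = n \<Longrightarrow> Poly_Mapping.single t 1 \<in> U"
  shows "p \<in> U"
  using assms(1,3) unfolding mag_deg_def by (blast intro: pm_in_subspace[OF assms(2)])

lemma single_in_mag_deg: "mag_len t = n \<Longrightarrow> Poly_Mapping.single t c \<in> mag_deg n"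
  by (simp add: mag_deg_def)

lemma presentation_free_lie:
  "presentation (free_lie scale) (vcoset free_vspace (lie_ideal scale)) UNIV (lie_ideal scale)"
  using presentation.presentation_vquot[OF presentation_free_vspace subspace_lie_ideal, of scale]
  by (auto simp: free_lie_def intro: lie_ideal.zero)

lemma presentation_free_lie_deg:
  "presentation (free_lie_deg scale n) (vcoset free_vspace (lie_ideal scale))
     (mag_deg n) (lie_ideal scale \<inter> mag_deg n)"
  unfolding free_lie_deg_def mag_deg_def[symmetric]
  by (rule presentation.presentation_vrestrict[OF presentation_free_lie subspace_mag_deg]) simp

text \<open>The ideal is two-sided, so changing either factor by an ideal element changes the
  product by one.\<close>

lemma fl_br_vcoset:
  "fl_br scale (vcoset free_vspace (lie_ideal scale) p) (vcoset free_vspace (lie_ideal scale) q)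
    = vcoset free_vspace (lie_ideal scale) (mag_mult p q)"
  (is "?L = ?R")
proof -
  have cos: "vcoset free_vspace (lie_ideal scale) p = {p + u |u. u \<in> lie_ideal scale}" for p
    by (simp add: vcoset_def free_vspace_def)
  show ?thesis
  proof (intro set_eqI iffI)
    fix z assume "z \<in> ?L"
    then obtain u v r where "z = mag_mult (p + u) (q + v) + r"
      and I: "u \<in> lie_ideal scale" "v \<in> lie_ideal scale" "r \<in> lie_ideal scale"
      by (auto simp: fl_br_def cos)
    then have "z = mag_mult p q + (mag_mult p v + mag_mult u (q + v) + r)"
      by (simp add: mag_mult_add_left mag_mult_add_right add_ac)
    then show "z \<in> ?R" using I unfolding cos by (blast intro: lie_ideal.intros)
  next
    fix z assume "z \<in> ?R"
    then obtain r where "z = mag_mult (p + 0) (q + 0) + r" "r \<in> lie_ideal scale" by (auto simp: cos)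
    then show "z \<in> ?L" unfolding fl_br_def cos by (blast intro: lie_ideal.zero)
  qed
qed

section \<open>Relations in degrees two and three\<close>

context lie_algebra begin

lemma lbr_simps:
  "lbr (x + y) z = lbr x z + lbr y z" "lbr x (y + z) = lbr x y + lbr x z"
  "lbr (scale c x) y = scale c (lbr x y)" "lbr x (scale c y) = scale c (lbr x y)"
  "lbr 0 y = 0"
proof -
  interpret l: Vector_Spaces.linear scale scale "\<lambda>x. lbr x w" for w by (rule lbr_linear_left)
  interpret r: Vector_Spaces.linear scale scale "\<lambda>y. lbr w y" for w by (rule lbr_linear_right)
  show "lbr (x + y) z = lbr x z + lbr y z" "lbr x (y + z) = lbr x y + lbr x z"
    "lbr (scale c x) y = scale c (lbr x y)" "lbr x (scale c y) = scale c (lbr x y)" "lbr 0 y = 0"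
    by (fact l.add r.add l.scale r.scale l.zero)+
qed

text \<open>Polarization of \<open>lbr_alternating\<close>. The sign is written as
  \<open>scale (- 1)\<close> to match the scaling relations of \<open>lie_ideal\<close> and
  \<open>trel\<close>: a formal generator or pair built from a negated vector is not literally a
  negated formal sum.\<close>

lemma lbr_anti: "lbr x y = scale (- 1) (lbr y x)"
proof -
  have "lbr x y + lbr y x = 0"
    using lbr_alternating[of "x + y"] unfolding lbr_simps by (simp add: lbr_alternating add.commute)
  then show ?thesis by (simp add: eq_neg_iff_add_eq_0)
qed

section \<open>Tensor relations on formal pairs and the derivation action of g\<close>

abbreviation tens :: "'g \<Rightarrow> 'g \<Rightarrow> ('g \<times> 'g \<Rightarrow>\<^sub>0 'k)" where
  "tens x y \<equiv> Poly_Mapping.single (x, y) 1"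

abbreviation trel :: "('g \<times> 'g \<Rightarrow>\<^sub>0 'k) set" where
  "trel \<equiv> tensor_rel scale"

lemma tensor_rel_eq_span:
  "trel = pm.span
     ({tens (x + x') y - tens x y - tens x' y |x x' y. True} \<union>
      {tens x (y + y') - tens x y - tens x y' |x y y'. True} \<union>
      {tens (scale c x) y - Poly_Mapping.single (x, y) c |c x y. True} \<union>
      {tens x (scale c y) - Poly_Mapping.single (x, y) c |c x y. True})"
  unfolding tensor_rel_def
  using presentation.vspan_eq[OF presentation_free_vspace]
  by (simp add: pm.span_insert_0)

lemma subspace_trel: "pm.subspace trel"
  unfolding tensor_rel_eq_span by (rule pm.subspace_span)

lemma trel_add_left: "tens (x + x') y - tens x y - tens x' y \<in> trel"
  and trel_add_right: "tens x (y + y') - tens x y - tens x y' \<in> trel"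
  and trel_scale_left: "tens (scale c x) y - c \<odot> tens x y \<in> trel"
  and trel_scale_right: "tens x (scale c y) - c \<odot> tens x y \<in> trel"
  unfolding tensor_rel_eq_span pm_scale_single mult_1_right by (rule pm.span_base, blast)+

lemma trel_zero_left: "tens 0 y \<in> trel" and trel_zero_right: "tens x 0 \<in> trel"
  using trel_scale_left[of 0 0 y] trel_scale_right[of x 0 0] by simp_all

lemma plext_trel:
  assumes "pm.subspace U"
    and "\<And>x x' y. plext \<phi> (tens (x + x') y - tens x y - tens x' y) \<in> U"
    and "\<And>x y y'. plext \<phi> (tens x (y + y') - tens x y - tens x y') \<in> U"
    and "\<And>c x y. plext \<phi> (tens (scale c x) y - c \<odot> tens x y) \<in> U"
    and "\<And>c x y. plext \<phi> (tens x (scale c y) - c \<odot> tens x y) \<in> U"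
    and "p \<in> trel"
  shows "plext \<phi> p \<in> U"
  using assms(2-5) unfolding pm_scale_single mult_1_right
  by (intro plext_span[OF _ assms(1) assms(6)[unfolded tensor_rel_eq_span]]) blast

text \<open>The extension of ad x to pairs by the Leibniz rule.\<close>

abbreviation act :: "'g \<Rightarrow> ('g \<times> 'g \<Rightarrow>\<^sub>0 'k) \<Rightarrow> ('g \<times> 'g \<Rightarrow>\<^sub>0 'k)" where
  "act x \<equiv> plext (\<lambda>(y, z). tens (lbr x y) z + tens y (lbr x z))"

text \<open>By the Leibniz rule the image of each defining relation is a sum of two relations of the
  same kind, one per tensor factor.\<close>

lemma act_trel:
  assumes "p \<in> trel"
  shows "act x p \<in> trel"
proof (rule plext_trel[OF subspace_trel _ _ _ _ assms])
  fix y y' z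
  have "act x (tens (y + y') z - tens y z - tens y' z) =
     (tens (lbr x y + lbr x y') z - tens (lbr x y) z - tens (lbr x y') z)
     + (tens (y + y') (lbr x z) - tens y (lbr x z) - tens y' (lbr x z))"
    by (simp add: lbr_simps algebra_simps)
  also have "\<dots> \<in> trel" by (intro pm.subspace_add[OF subspace_trel] trel_add_left)
  finally show "act x (tens (y + y') z - tens y z - tens y' z) \<in> trel" .
next
  fix y z z'
  have "act x (tens y (z + z') - tens y z - tens y z') =
     (tens (lbr x y) (z + z') - tens (lbr x y) z - tens (lbr x y) z')
     + (tens y (lbr x z + lbr x z') - tens y (lbr x z) - tens y (lbr x z'))"
    by (simp add: lbr_simps algebra_simps)
  also have "\<dots> \<in> trel" by (intro pm.subspace_add[OF subspace_trel] trel_add_right)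
  finally show "act x (tens y (z + z') - tens y z - tens y z') \<in> trel" .
next
  fix c y z
  have "act x (tens (scale c y) z - c \<odot> tens y z) =
     (tens (scale c (lbr x y)) z - c \<odot> tens (lbr x y) z)
     + (tens (scale c y) (lbr x z) - c \<odot> tens y (lbr x z))"
    by (simp add: lbr_simps pm.scale_right_distrib algebra_simps)
  also have "\<dots> \<in> trel" by (intro pm.subspace_add[OF subspace_trel] trel_scale_left)
  finally show "act x (tens (scale c y) z - c \<odot> tens y z) \<in> trel" .
next
  fix c y z
  have "act x (tens y (scale c z) - c \<odot> tens y z) =
     (tens (lbr x y) (scale c z) - c \<odot> tens (lbr x y) z)
     + (tens y (scale c (lbr x z)) - c \<odot> tens y (lbr x z))"
    by (simp add: lbr_simps pm.scale_right_distrib algebra_simps)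
  also have "\<dots> \<in> trel" by (intro pm.subspace_add[OF subspace_trel] trel_scale_right)
  finally show "act x (tens y (scale c z) - c \<odot> tens y z) \<in> trel" .
qed

text \<open>The defect is itself a linear extension in \<open>w\<close>, so it suffices that its
  value on each pair is a tensor relation.\<close>

lemma act_add_left: "act (x + x') w - act x w - act x' w \<in> trel"
proof -
  have "act (x + x') w - act x w - act x' w =
    plext (\<lambda>(y, z). (tens (lbr x y + lbr x' y) z - tens (lbr x y) z - tens (lbr x' y) z)
      + (tens y (lbr x z + lbr x' z) - tens y (lbr x z) - tens y (lbr x' z))) w"
    unfolding pm.lext_diff_fun[symmetric]
    by (rule lext_cong) (auto simp: lbr_simps algebra_simps)
  also have "\<dots> \<in> trel"
    by (intro pm.lext_mem subspace_trel)
      (auto intro!: pm.subspace_add[OF subspace_trel] trel_add_left trel_add_right)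
  finally show ?thesis .
qed

lemma act_scale_left: "act (scale c x) w - c \<odot> act x w \<in> trel"
proof -
  have "act (scale c x) w - c \<odot> act x w =
    plext (\<lambda>(y, z). (tens (scale c (lbr x y)) z - c \<odot> tens (lbr x y) z)
      + (tens y (scale c (lbr x z)) - c \<odot> tens y (lbr x z))) w"
    unfolding pm.lext_diff_fun[symmetric] pm.lext_scale_fun[symmetric]
    by (rule lext_cong) (auto simp: lbr_simps pm.scale_right_distrib algebra_simps)
  also have "\<dots> \<in> trel"
    by (intro pm.lext_mem subspace_trel)
      (auto intro!: pm.subspace_add[OF subspace_trel]
        trel_scale_left[unfolded pm_scale_single mult_1_right]
        trel_scale_right[unfolded pm_scale_single mult_1_right])
  finally show ?thesis .
qed

lemma act_zero_left: "act 0 w \<in> trel"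
  using act_scale_left[of 0 0 w] by simp

definition srel :: "('g \<times> 'g \<Rightarrow>\<^sub>0 'k) set" where
  "srel = pm.span (trel \<union> {tens x y - tens y x |x y. True})"

lemma subspace_srel: "pm.subspace srel"
  unfolding srel_def by (rule pm.subspace_span)

lemma trel_srel: "p \<in> trel \<Longrightarrow> p \<in> srel"
  unfolding srel_def by (rule pm.span_base) blast

lemma srel_sym: "tens x y - tens y x \<in> srel"
  unfolding srel_def by (rule pm.span_base) blast

text \<open>A derivation acts on both factors alike and so commutes with exchanging them. This is
  what lets a generator multiply a quadratic relation in \<open>lie_ideal_maps\<close>.\<close>

lemma act_srel:
  assumes "p \<in> srel"
  shows "act x p \<in> srel"
proof (rule plext_span[OF _ subspace_srel assms[unfolded srel_def]])
  fix s assume "s \<in> trel \<union> {tens x y - tens y x |x y. True}"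
  then consider "s \<in> trel" | y z where "s = tens y z - tens z y" by blast
  then show "act x s \<in> srel"
  proof cases
    case 1
    then show ?thesis by (intro trel_srel act_trel)
  next
    case 2
    have "act x s = (tens (lbr x y) z - tens z (lbr x y)) + (tens y (lbr x z) - tens (lbr x z) y)"
      unfolding 2 by (simp add: algebra_simps)
    also have "\<dots> \<in> srel" by (intro pm.subspace_add[OF subspace_srel] srel_sym)
    finally show ?thesis .
  qed
qed

section \<open>Linear, quadratic and cubic parts of trees, and their values on the ideal\<close>

fun lin1 :: "'g mag \<Rightarrow> 'g" where
  "lin1 (Gen x) = x"
| "lin1 (Br _ _) = 0"

text \<open>On a tree with more than two leaves some entry of the pair is 0; the value is then a
  tensor relation, though not the formal sum 0.\<close>

fun quad :: "'g mag \<Rightarrow> ('g \<times> 'g \<Rightarrow>\<^sub>0 'k)" where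
  "quad (Gen _) = 0"
| "quad (Br s t) = tens (lin1 s) (lin1 t)"

text \<open>
  The differential on trees with three leaves, \<open>\<^bold>d (x, (y, z)) = x \<cdot> (y, z)\<close> with \<open>x\<close> acting
  as a derivation. On trees of other lengths the value is junk in the tensor relations.
\<close>

fun cubic :: "'g mag \<Rightarrow> ('g \<times> 'g \<Rightarrow>\<^sub>0 'k)" where
  "cubic (Gen _) = 0"
| "cubic (Br s t) = act (lin1 s) (quad t) - act (lin1 t) (quad s)"

abbreviation lin :: "('g mag \<Rightarrow>\<^sub>0 'k) \<Rightarrow> 'g" where
  "lin \<equiv> lext scale lin1"

lemma lin1_eq_0: "mag_len t \<noteq> 1 \<Longrightarrow> lin1 t = 0"
  by (cases t) auto

lemma quad_trel: "mag_len t \<noteq> 2 \<Longrightarrow> quad t \<in> trel"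
proof (cases t)
  case (Br s u)
  assume "mag_len t \<noteq> 2"
  then have "mag_len s \<noteq> 1 \<or> mag_len u \<noteq> 1" using Br by auto
  then show ?thesis using Br lin1_eq_0 trel_zero_left trel_zero_right by auto
qed (simp add: pm.subspace_0[OF subspace_trel])

lemma cubic_trel: "mag_len t \<noteq> 3 \<Longrightarrow> cubic t \<in> trel"
proof (cases t)
  case (Br s u)
  assume "mag_len t \<noteq> 3"
  then have "mag_len s \<noteq> 1 \<or> mag_len u \<noteq> 2" "mag_len u \<noteq> 1 \<or> mag_len s \<noteq> 2" using Br by auto
  then have "lin1 s = 0 \<or> quad u \<in> trel" "lin1 u = 0 \<or> quad s \<in> trel"
    using lin1_eq_0 quad_trel by blast+
  moreover have "act x w \<in> trel" if "x = 0 \<or> w \<in> trel" for x w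
    using that by (elim disjE) (simp only: act_zero_left, rule act_trel)
  ultimately have "act (lin1 s) (quad u) \<in> trel" "act (lin1 u) (quad s) \<in> trel"
    by blast+
  then show ?thesis using Br pm.subspace_diff[OF subspace_trel] by simp
qed (simp add: pm.subspace_0[OF subspace_trel])

lemma lin_mag_mult: "lin (mag_mult p q) = 0"
  by (simp add: mag_mult_def lext_sum)

text \<open>On two trees this is the definition of \<open>quad\<close>. Bilinear extension costs an
  error in \<open>trel\<close>, because forming a pair from sums of vectors is not additive on
  formal sums.\<close>

lemma quad_mag_mult: "plext quad (mag_mult p q) - tens (lin p) (lin q) \<in> trel"
proof (rule bilinear_mem[where G = "\<lambda>p q. plext quad (mag_mult p q) - tens (lin p) (lin q)", OF subspace_trel])
  fix p p' q q' :: "'g mag \<Rightarrow>\<^sub>0 'k" and c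
  note neg = pm.subspace_neg[OF subspace_trel]
  show "plext quad (mag_mult (p + p') q) - tens (lin (p + p')) (lin q)
      - (plext quad (mag_mult p q) - tens (lin p) (lin q))
      - (plext quad (mag_mult p' q) - tens (lin p') (lin q)) \<in> trel"
    using neg[OF trel_add_left[of "lin p" "lin p'" "lin q"]]
    by (simp add: mag_mult_add_left algebra_simps)
  show "plext quad (mag_mult p (q + q')) - tens (lin p) (lin (q + q'))
      - (plext quad (mag_mult p q) - tens (lin p) (lin q))
      - (plext quad (mag_mult p q') - tens (lin p) (lin q')) \<in> trel"
    using neg[OF trel_add_right[of "lin p" "lin q" "lin q'"]]
    by (simp add: mag_mult_add_right algebra_simps)
  show "plext quad (mag_mult (c \<odot> p) q) - tens (lin (c \<odot> p)) (lin q)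
      - c \<odot> (plext quad (mag_mult p q) - tens (lin p) (lin q)) \<in> trel"
    using neg[OF trel_scale_left[of c "lin p" "lin q"]]
    by (simp add: mag_mult_scale_left pm.scale_right_diff_distrib algebra_simps)
  show "plext quad (mag_mult p (c \<odot> q)) - tens (lin p) (lin (c \<odot> q))
      - c \<odot> (plext quad (mag_mult p q) - tens (lin p) (lin q)) \<in> trel"
    using neg[OF trel_scale_right[of "lin p" c "lin q"]]
    by (simp add: mag_mult_scale_right pm.scale_right_diff_distrib algebra_simps)
qed (simp add: pm.subspace_0[OF subspace_trel])

text \<open>Expresses the cubic part of a product through the lower parts of its factors, whatever
  their lengths. The induction over the ideal needs this because the multiplier there is an
  arbitrary formal sum.\<close>

lemma cubic_mag_mult:
  "plext cubic (mag_mult p q) - (act (lin p) (plext quad q) - act (lin q) (plext quad p)) \<in> trel"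
  (is "?G p q \<in> trel")
proof (rule bilinear_mem[where G = ?G, OF subspace_trel])
  fix p p' q q' :: "'g mag \<Rightarrow>\<^sub>0 'k" and c
  note neg = pm.subspace_neg[OF subspace_trel]
  show "?G (p + p') q - ?G p q - ?G p' q \<in> trel"
    using neg[OF act_add_left[of "lin p" "lin p'" "plext quad q"]]
    by (simp add: mag_mult_add_left algebra_simps)
  show "?G p (q + q') - ?G p q - ?G p q' \<in> trel"
    using act_add_left[of "lin q" "lin q'" "plext quad p"]
    by (simp add: mag_mult_add_right algebra_simps)
  show "?G (c \<odot> p) q - c \<odot> ?G p q \<in> trel"
    using neg[OF act_scale_left[of c "lin p" "plext quad q"]]
    by (simp add: mag_mult_scale_left pm.scale_right_diff_distrib algebra_simps)
  show "?G p (c \<odot> q) - c \<odot> ?G p q \<in> trel"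
    using act_scale_left[of c "lin q" "plext quad p"]
    by (simp add: mag_mult_scale_right pm.scale_right_diff_distrib algebra_simps)
qed (simp add: pm.subspace_0[OF subspace_trel])

lemma tens_neg_left: "tens (lbr x y) z + tens (lbr y x) z \<in> trel"
  using trel_scale_left[of "- 1" "lbr y x" z] lbr_anti[of x y] by (simp add: single_uminus)

lemma tens_neg_right: "tens z (lbr x y) + tens z (lbr y x) \<in> trel"
  using trel_scale_right[of z "- 1" "lbr y x"] lbr_anti[of x y] by (simp add: single_uminus)

text \<open>For two leaves the sign is -1, leaving a symmetry relation of \<open>srel\<close>. For
  three leaves the lengths are 1 and 2, the sign is +1, and \<open>cubic\<close> changes sign when
  its subtrees are exchanged. Other lengths give tensor relations.\<close>

lemma antisym_relation_srel:
  fixes a b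
  defines "p \<equiv> Poly_Mapping.single (Br a b) 1 + Poly_Mapping.single (Br b a) ((- 1) ^ (mag_len a * mag_len b))"
  shows "plext quad p \<in> srel" "plext cubic p \<in> srel"
proof -
  let ?s = "(- 1 :: 'k) ^ (mag_len a * mag_len b)"
  have p: "plext \<phi> p = \<phi> (Br a b) + ?s \<odot> \<phi> (Br b a)" for \<phi> :: "'g mag \<Rightarrow> ('g \<times> 'g \<Rightarrow>\<^sub>0 'k)"
    by (simp add: p_def)
  show "plext quad p \<in> srel"
  proof (cases "mag_len (Br a b) = 2")
    case True
    then obtain x y where "a = Gen x" "b = Gen y" unfolding mag_len_eq_2 by auto
    then show ?thesis using srel_sym[of x y] by (simp add: p single_uminus)
  next
    case False
    then have "quad (Br a b) \<in> trel" "quad (Br b a) \<in> trel" by (intro quad_trel; simp)+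
    then show ?thesis unfolding p
      by (intro trel_srel pm.subspace_add pm.subspace_scale subspace_trel)
  qed
  show "plext cubic p \<in> srel"
  proof (cases "mag_len (Br a b) = 3")
    case True
    then have "?s = 1" unfolding mag_len_eq_3 by auto
    then show ?thesis by (simp add: p pm.subspace_0[OF subspace_srel])
  next
    case False
    then have "cubic (Br a b) \<in> trel" "cubic (Br b a) \<in> trel" by (intro cubic_trel; simp)+
    then show ?thesis unfolding p
      by (intro trel_srel pm.subspace_add pm.subspace_scale subspace_trel)
  qed
qed

text \<open>Every tree here has at least three leaves, so only \<open>cubic\<close> has content, and
  only when a, b, c are generators; the sign is then -1.\<close>

lemma jacobi_relation_srel:
  fixes a b c
  defines "p \<equiv> Poly_Mapping.single (Br a (Br b c)) 1 - Poly_Mapping.single (Br (Br a b) c) 1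
      - Poly_Mapping.single (Br b (Br a c)) ((- 1) ^ (mag_len a * mag_len b))"
  shows "plext quad p \<in> srel" "plext cubic p \<in> srel"
proof -
  let ?s = "(- 1 :: 'k) ^ (mag_len a * mag_len b)"
  have p: "plext \<phi> p = \<phi> (Br a (Br b c)) - \<phi> (Br (Br a b) c) - ?s \<odot> \<phi> (Br b (Br a c))"
    for \<phi> :: "'g mag \<Rightarrow> ('g \<times> 'g \<Rightarrow>\<^sub>0 'k)"
    by (simp add: p_def)
  have len: "mag_len a + mag_len b + mag_len c \<ge> 3"
    using mag_len_pos[of a] mag_len_pos[of b] mag_len_pos[of c] by linarith
  have "quad (Br a (Br b c)) \<in> trel" "quad (Br (Br a b) c) \<in> trel" "quad (Br b (Br a c)) \<in> trel"
    by (rule quad_trel, use len in simp)+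
  then show "plext quad p \<in> srel" unfolding p
    by (intro trel_srel pm.subspace_diff pm.subspace_scale subspace_trel)
  show "plext cubic p \<in> srel"
  proof (cases "mag_len a + mag_len b + mag_len c = 3")
    case True
    then have "mag_len a = Suc 0" "mag_len b = Suc 0" "mag_len c = Suc 0"
      using mag_len_pos[of a] mag_len_pos[of b] mag_len_pos[of c] by linarith+
    then obtain x y z where abc: "a = Gen x" "b = Gen y" "c = Gen z" by (auto simp: mag_len_eq_1)
    \<comment> \<open>The six terms form three pairs differing by antisymmetry of the bracket in one
      factor. For \<open>[z, x]\<close> with \<open>y\<close> the partner has its factors in the
      other order, so \<open>tens (lbr x z) y\<close> is added and subtracted.\<close>
    have "plext cubic p =
        (tens (lbr x y) z + tens (lbr y x) z)
        + (tens (lbr z x) y + tens (lbr x z) y) - (tens (lbr x z) y - tens y (lbr x z))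
        + (tens x (lbr z y) + tens x (lbr y z))"
      unfolding p abc by (simp add: single_uminus algebra_simps)
    also have "\<dots> \<in> srel"
      by (intro pm.subspace_add[OF subspace_srel] pm.subspace_diff[OF subspace_srel] srel_sym
          trel_srel tens_neg_left tens_neg_right)
    finally show ?thesis .
  next
    case False
    then have "cubic (Br a (Br b c)) \<in> trel" "cubic (Br (Br a b) c) \<in> trel" "cubic (Br b (Br a c)) \<in> trel"
      by (intro cubic_trel; simp)+
    then show ?thesis unfolding p
      by (intro trel_srel pm.subspace_diff pm.subspace_scale subspace_trel)
  qed
qed

text \<open>The three claims support each other: in a product with an ideal element, the quadratic
  part is controlled by the linear parts, and the cubic part by the linear and quadratic
  ones.\<close>

lemma lie_ideal_maps:
  assumes "p \<in> lie_ideal scale"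
  shows "lin p = 0 \<and> plext quad p \<in> srel \<and> plext cubic p \<in> srel"
  using assms
proof (induction rule: lie_ideal.induct)
  case (antisym a b)
  show ?case
    by (intro conjI antisym_relation_srel) simp
next
  case (jacobi a b c)
  show ?case
    by (intro conjI jacobi_relation_srel) simp
next
  case (add p q)
  then show ?case using pm.subspace_add[OF subspace_srel] by simp
next
  case (smult p c)
  then show ?case using pm.subspace_scale[OF subspace_srel] by simp
next
  case (mult_left p q)
  then have IH: "lin p = 0" "plext quad p \<in> srel" by blast+
  have "plext quad (mag_mult q p) \<in> trel"
    using pm.subspace_add[OF subspace_trel quad_mag_mult trel_zero_right, of q p "lin q"]
    unfolding IH(1) diff_add_cancel .
  \<comment> \<open>The first term lies in \<open>srel\<close> because the derivation action
    preserves it; in the second the acting vector is 0.\<close>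
  moreover have "act (lin q) (plext quad p) - act (lin p) (plext quad q) \<in> srel"
    unfolding IH(1) using IH(2) by (intro pm.subspace_diff[OF subspace_srel] act_srel trel_srel[OF act_zero_left])
  from pm.subspace_add[OF subspace_srel trel_srel[OF cubic_mag_mult[of q p]] this]
  have "plext cubic (mag_mult q p) \<in> srel" unfolding diff_add_cancel .
  ultimately show ?case by (intro conjI lin_mag_mult) (auto intro: trel_srel)
next
  case (mult_right p q)
  then have IH: "lin p = 0" "plext quad p \<in> srel" by blast+
  have "plext quad (mag_mult p q) \<in> trel"
    using pm.subspace_add[OF subspace_trel quad_mag_mult trel_zero_left, of p q "lin q"]
    unfolding IH(1) diff_add_cancel .
  moreover have "act (lin p) (plext quad q) - act (lin q) (plext quad p) \<in> srel"
    unfolding IH(1) using IH(2) by (intro pm.subspace_diff[OF subspace_srel] act_srel trel_srel[OF act_zero_left])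
  from pm.subspace_add[OF subspace_srel trel_srel[OF cubic_mag_mult[of p q]] this]
  have "plext cubic (mag_mult p q) \<in> srel" unfolding diff_add_cancel .
  ultimately show ?case by (intro conjI lin_mag_mult) (auto intro: trel_srel)
next
  case (gen_add x y)
  show ?case by (simp add: pm.subspace_0[OF subspace_srel])
next
  case (gen_scale c x)
  show ?case by (simp add: pm.subspace_0[OF subspace_srel])
next
  case zero
  show ?case by (simp add: pm.subspace_0[OF subspace_srel])
qed

end

section \<open>Homology and \<open>\<Omega>\<^sup>0\<close>\<close>

context lie_algebra begin

abbreviation cls :: "('g mag \<Rightarrow>\<^sub>0 'k) \<Rightarrow> ('g mag \<Rightarrow>\<^sub>0 'k) set" where
  "cls \<equiv> vcoset free_vspace (lie_ideal scale)"

sublocale FL: presentation "free_lie scale" cls UNIV "lie_ideal scale"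
  by (rule presentation_free_lie)

text \<open>\<open>Omega0_rel\<close> pulled back to formal pairs; with \<open>trel\<close>
  included, the two-stage quotient defining \<open>Omega0\<close> becomes a single one.\<close>

definition orel :: "('g \<times> 'g \<Rightarrow>\<^sub>0 'k) set" where
  "orel = pm.span ({tens x y - tens y x |x y. True}
     \<union> {tens (lbr x y) z - tens x (lbr y z) |x y z. True} \<union> trel)"

lemma subspace_orel: "pm.subspace orel"
  unfolding orel_def by (rule pm.subspace_span)

lemma trel_orel: "p \<in> trel \<Longrightarrow> p \<in> orel"
  unfolding orel_def by (rule pm.span_base) blast

lemma orel_invariant: "tens (lbr x y) z - tens x (lbr y z) \<in> orel"
  unfolding orel_def by (rule pm.span_base) blast

lemma srel_orel: "srel \<subseteq> orel"
  unfolding srel_def orel_def by (rule pm.span_mono) blast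

text \<open>The second relation of \<open>Omega0\<close> is ad-invariance of the pairing, which says
  that every derivation action becomes zero.\<close>

lemma act_orel: "act x w \<in> orel"
proof (rule pm.lext_mem[OF subspace_orel], clarsimp)
  fix y z
  have "tens (lbr x y) z + tens y (lbr x z)
      = (tens (lbr x y) z + tens (lbr y x) z) - (tens (lbr y x) z - tens y (lbr x z))"
    by simp
  also have "\<dots> \<in> orel"
    by (intro pm.subspace_diff[OF subspace_orel] trel_orel tens_neg_left orel_invariant)
  finally show "tens (lbr x y) z + tens y (lbr x z) \<in> orel" .
qed

lemma cubic_orel: "cubic t \<in> orel"
  by (cases t) (auto intro!: pm.subspace_diff[OF subspace_orel] act_orel pm.subspace_0[OF subspace_orel])

lemma presentation_Omega0:
  "presentation (Omega0 scale lbr) (\<lambda>p. Omega0_class scale lbr (vcoset free_vspace trel p)) UNIV orel"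
proof -
  have "presentation (tensor_square scale) (vcoset free_vspace trel) UNIV trel"
    using presentation.presentation_vquot[OF presentation_free_vspace subspace_trel]
    by (auto simp: tensor_square_def pm.subspace_0[OF subspace_trel])
  then interpret T: presentation "tensor_square scale" "vcoset free_vspace trel" UNIV trel .
  have vd: "vdiff (tensor_square scale) (vcoset free_vspace trel p) (vcoset free_vspace trel q)
      = vcoset free_vspace trel (p - q)" for p q
    by (simp add: vdiff_def T.scale_eq T.add_eq)
  have "Omega0_rel scale lbr = vcoset free_vspace trel ` orel"
    unfolding Omega0_rel_def orel_def tensor_def vd T.vspan_eq[OF refl, symmetric]
    by (rule arg_cong[where f = "vspan (tensor_square scale)"]) blast
  then show ?thesis
    using T.presentation_vquot[OF subspace_orel] trel_orel
    by (auto simp: Omega0_def Omega0_class_def)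
qed

section \<open>Formal pairs versus trees with two leaves\<close>

definition tree2 :: "'g \<times> 'g \<Rightarrow> ('g mag \<Rightarrow>\<^sub>0 'k)" where
  "tree2 = (\<lambda>(x, y). Poly_Mapping.single (Br (Gen x) (Gen y)) 1)"

text \<open>A tensor relation becomes a linearity relation between generators multiplied on the left
  or right by a generator, so two-sidedness of the ideal suffices.\<close>

lemma tree2_trel:
  assumes "p \<in> trel"
  shows "plext tree2 p \<in> lie_ideal scale"
proof (rule plext_trel[OF subspace_lie_ideal _ _ _ _ assms])
  fix x x' y :: 'g and c
  let ?g = "\<lambda>x. Poly_Mapping.single (Gen x) 1 :: 'g mag \<Rightarrow>\<^sub>0 'k"
  have add: "?g (x + x') - ?g x - ?g x' \<in> lie_ideal scale" for x x' by (rule lie_ideal.gen_add)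
  have scal: "?g (scale c x) - c \<odot> ?g x \<in> lie_ideal scale" for x
    using lie_ideal.gen_scale[of scale c x] by simp
  show "plext tree2 (tens (x + x') y - tens x y - tens x' y) \<in> lie_ideal scale"
    using lie_ideal.mult_right[OF add, of x x' "?g y"] by (simp add: tree2_def mag_mult_diff_left)
  show "plext tree2 (tens y (x + x') - tens y x - tens y x') \<in> lie_ideal scale"
    using lie_ideal.mult_left[OF add, of "?g y" x x'] by (simp add: tree2_def mag_mult_diff_right)
  show "plext tree2 (tens (scale c x) y - c \<odot> tens x y) \<in> lie_ideal scale"
    using lie_ideal.mult_right[OF scal, of x "?g y"] by (simp add: tree2_def mag_mult_diff_left)
  show "plext tree2 (tens y (scale c x) - c \<odot> tens y x) \<in> lie_ideal scale"
    using lie_ideal.mult_left[OF scal, of "?g y" x] by (simp add: tree2_def mag_mult_diff_right)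
qed

lemma tree2_sym: "plext tree2 (tens x y - tens y x) \<in> lie_ideal scale"
  using lie_ideal.antisym[of "Gen x" "Gen y" scale] by (simp add: tree2_def single_uminus)

lemma tree2_srel:
  assumes "p \<in> srel"
  shows "plext tree2 p \<in> lie_ideal scale"
  using assms unfolding srel_def
  by (rule plext_span[OF _ subspace_lie_ideal, rotated]) (use tree2_trel tree2_sym in blast)

lemma tree2_mag_deg: "plext tree2 p \<in> mag_deg 2"
  by (rule pm.lext_mem[OF subspace_mag_deg]) (auto simp: tree2_def intro: single_in_mag_deg)

text \<open>Together with \<open>tree2_quad\<close> this is an exact bijection between formal pairs
  and sums of two-leaf trees, so only the relations on the two sides remain to be compared.\<close>

lemma quad_tree2 [simp]: "plext quad (plext tree2 q) = q"
proof -
  have "plext quad (plext tree2 q) = plext (\<lambda>t. Poly_Mapping.single t 1) q"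
    unfolding plext_plext by (rule lext_cong) (auto simp: tree2_def)
  then show ?thesis by simp
qed

lemma tree2_quad:
  assumes "p \<in> mag_deg 2"
  shows "plext tree2 (plext quad p) = p"
proof -
  have "plext tree2 (plext quad p) = plext (\<lambda>t. Poly_Mapping.single t 1) p"
    unfolding plext_plext using assms
    by (intro lext_cong) (auto simp: tree2_def mag_deg_def mag_len_eq_2)
  then show ?thesis by simp
qed

section \<open>The differential in degrees two and three\<close>

abbreviation d3 :: "'g mag \<Rightarrow> ('g mag \<Rightarrow>\<^sub>0 'k)" where
  "d3 t \<equiv> plext tree2 (cubic t)"

lemma plext_d3: "plext d3 p = plext tree2 (plext cubic p)"
  by (simp add: plext_plext)

lemma nest3: "nest scale [x, y, z] = cls (Poly_Mapping.single (Br (Gen x) (Br (Gen y) (Gen z))) 1)"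
  by (simp add: fl_gen_def fl_br_vcoset)

lemma nest2: "nest scale [x, y] = cls (plext tree2 (tens x y))"
  by (simp add: fl_gen_def fl_br_vcoset tree2_def)

lemma rhs2: "lie_diff_rhs scale lbr (Suc 0) [x, y] = cls 0"
proof -
  let ?g = "\<lambda>x. Poly_Mapping.single (Gen x) 1 :: 'g mag \<Rightarrow>\<^sub>0 'k"
  have "lie_diff_rhs scale lbr (Suc 0) [x, y] = cls (?g (lbr x y) + ?g (lbr y x))"
    by (simp add: lie_diff_rhs_def vsum_list_def contract_at_def fl_gen_def
        FL.zero_eq FL.add_eq FL.scale_eq)
  moreover have "?g (lbr x y) + ?g (lbr y x) \<in> lie_ideal scale"
    using lie_ideal.gen_scale[of scale "- 1" "lbr y x"] lbr_anti[of x y] by (simp add: single_uminus)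
  ultimately show ?thesis using FL.eq_iff by simp
qed

lemma rhs3: "lie_diff_rhs scale lbr 2 [x, y, z]
  = cls (plext d3 (Poly_Mapping.single (Br (Gen x) (Br (Gen y) (Gen z))) 1))"
proof -
  let ?t = "\<lambda>x y. plext tree2 (tens x y)"
  \<comment> \<open>The index pairs (1,2) and (1,3) have sign +1; (2,3) and the final correction
    term have sign -1.\<close>
  have "lie_diff_rhs scale lbr 2 [x, y, z]
    = cls (?t (lbr x y) z + ?t y (lbr x z) - ?t x (lbr y z) - ?t x (lbr z y))"
    by (simp add: lie_diff_rhs_def vsum_list_def contract_at_def upt_conv_Cons nest2
        FL.zero_eq FL.add_eq FL.scale_eq numeral_2_eq_2 algebra_simps del: nest.simps pm.lext_single)
  moreover have "?t x (lbr y z) + ?t x (lbr z y) \<in> lie_ideal scale"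
    using tree2_trel[OF tens_neg_right] by simp
  moreover have "plext d3 (Poly_Mapping.single (Br (Gen x) (Br (Gen y) (Gen z))) 1)
      = ?t (lbr x y) z + ?t y (lbr x z)"
    by simp
  moreover have "cls (p - q - r) = cls p" if "q + r \<in> lie_ideal scale" for p q r
    using pm.subspace_neg[OF subspace_lie_ideal that] FL.eq_iff[of "p - q - r" p]
    by (simp add: algebra_simps)
  ultimately show ?thesis by simp
qed

text \<open>A witness \<open>D\<close> only shows that the choice in \<open>lie_diff\<close>
  succeeds. The chosen map inherits the specification, not equality with \<open>D\<close>, so its
  values must be recomputed from the specification.\<close>

lemma lie_diff_spec:
  assumes "n = Suc m" "0 < m" "vlinear (free_lie_deg scale n) (free_lie_deg scale m) D"
    and "\<And>xs. length xs = n \<Longrightarrow> D (nest scale xs) = lie_diff_rhs scale lbr m xs"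
  shows "vlinear (free_lie_deg scale n) (free_lie_deg scale m) (lie_diff scale lbr n)"
    and "length xs = n \<Longrightarrow> lie_diff scale lbr n (nest scale xs) = lie_diff_rhs scale lbr m xs"
proof -
  let ?P = "\<lambda>D. vlinear (free_lie_deg scale n) (free_lie_deg scale m) D \<and>
    (\<forall>xs. length xs = n \<longrightarrow> D (nest scale xs) = lie_diff_rhs scale lbr m xs)"
  have "lie_diff scale lbr n = (SOME D. ?P D)"
    using assms(1,2) by (simp add: lie_diff_def)
  moreover have "?P (SOME D. ?P D)"
    by (rule someI[of ?P D]) (use assms(3,4) in blast)
  ultimately have "?P (lie_diff scale lbr n)" by simp
  then show "vlinear (free_lie_deg scale n) (free_lie_deg scale m) (lie_diff scale lbr n)"
    and "length xs = n \<Longrightarrow> lie_diff scale lbr n (nest scale xs) = lie_diff_rhs scale lbr m xs"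
    by blast+
qed

text \<open>Reduces agreement of a chosen differential with an explicit formula to a check on single
  trees, through \<open>mag_deg_induct\<close>.\<close>

lemma subspace_vlinear_agree:
  assumes "vlinear (free_lie_deg scale n) (free_lie_deg scale m) D"
    and E: "\<And>t. mag_len t = n \<Longrightarrow> \<phi> t \<in> mag_deg m"
  shows "pm.subspace {p \<in> mag_deg n. D (cls p) = cls (plext \<phi> p)}"
proof -
  interpret N: presentation "free_lie_deg scale n" cls "mag_deg n" "lie_ideal scale \<inter> mag_deg n"
    by (rule presentation_free_lie_deg)
  interpret M: presentation "free_lie_deg scale m" cls "mag_deg m" "lie_ideal scale \<inter> mag_deg m"
    by (rule presentation_free_lie_deg)
  have mem: "plext \<phi> p \<in> mag_deg m" if "p \<in> mag_deg n" for p
    using that E by (intro pm.lext_mem M.sub_A) (auto simp: mag_deg_def)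
  have add: "D (cls (p + q)) = vadd (free_lie_deg scale m) (D (cls p)) (D (cls q))"
    if "p \<in> mag_deg n" "q \<in> mag_deg n" for p q
    using assms(1) that unfolding vlinear_def N.carrier_eq by (simp add: N.add_eq[symmetric])
  have scal: "D (cls (c \<odot> p)) = vscale (free_lie_deg scale m) c (D (cls p))"
    if "p \<in> mag_deg n" for c p
    using assms(1) that unfolding vlinear_def N.carrier_eq by (simp add: N.scale_eq[symmetric])
  have zero: "(0 :: 'g mag \<Rightarrow>\<^sub>0 'k) \<in> mag_deg n" by (rule pm.subspace_0[OF N.sub_A])
  \<comment> \<open>\<open>vlinear\<close> says nothing about zero; scaling by 0 gives it, once the
    value at zero is known to have a representative.\<close>
  obtain w where w: "w \<in> mag_deg m" "D (cls 0) = cls w"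
    using assms(1) zero unfolding vlinear_def N.carrier_eq M.carrier_eq by blast
  have "D (cls 0) = cls 0"
    using scal[OF zero, of 0] M.scale_eq[OF w(1), of 0] w(2) by simp
  then show ?thesis
    using zero
    by (intro pm.subspaceI)
      (auto simp: add scal mem M.add_eq M.scale_eq pm.subspace_add[OF N.sub_A] pm.subspace_scale[OF N.sub_A])
qed

lemma lie_diff_2:
  assumes "p \<in> mag_deg 2"
  shows "lie_diff scale lbr 2 (cls p) = cls 0"
proof -
  have ext0: "plext (\<lambda>_. 0) q = 0" for q :: "'g mag \<Rightarrow>\<^sub>0 'k" by (simp add: lext_def)
  obtain D where D: "vlinear (free_lie_deg scale 2) (free_lie_deg scale (Suc 0)) D"
      "\<And>p. p \<in> mag_deg 2 \<Longrightarrow> D (cls p) = cls 0"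
    using presentation.vlinear_lift[OF presentation_free_lie_deg presentation_free_lie_deg,
        of 2 "\<lambda>_. 0" "Suc 0" scale]
    unfolding ext0 by (metis Int_iff lie_ideal.zero pm.subspace_0 subspace_mag_deg)
  have "D (nest scale xs) = lie_diff_rhs scale lbr (Suc 0) xs" if len: "length xs = 2" for xs
  proof -
    obtain x y where "xs = [x, y]"
      using len by (auto simp: numeral_2_eq_2 length_Suc_conv)
    then show ?thesis using D(2)[OF tree2_mag_deg[of "tens x y"]] by (simp only: nest2 rhs2)
  qed
  note spec = lie_diff_spec[OF _ _ D(1) this, simplified]
  let ?S = "{p \<in> mag_deg 2. lie_diff scale lbr 2 (cls p) = cls 0}"
  have "p \<in> ?S"
  proof (rule mag_deg_induct[OF assms])
    show "pm.subspace ?S"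
      using subspace_vlinear_agree[OF spec(1), of "\<lambda>_. 0"] pm.subspace_0[OF subspace_mag_deg]
      unfolding ext0 by blast
    fix t :: "'g mag" assume "mag_len t = 2"
    then obtain x y where t: "t = Br (Gen x) (Gen y)" unfolding mag_len_eq_2 by blast
    have "plext tree2 (tens x y) = Poly_Mapping.single t 1" by (simp add: t tree2_def)
    then show "Poly_Mapping.single t 1 \<in> ?S"
      using spec(2)[of "[x, y]"] tree2_mag_deg[of "tens x y"] unfolding nest2 rhs2 by simp
  qed
  then show ?thesis by simp
qed

lemma lie_diff_3:
  assumes "p \<in> mag_deg 3"
  shows "lie_diff scale lbr 3 (cls p) = cls (plext d3 p)"
proof -
  let ?u = "\<lambda>x y z. Poly_Mapping.single (Br (Gen x) (Br (Gen y) (Gen z))) (1 :: 'k)"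
  have u: "?u x y z \<in> mag_deg 3" for x y z by (intro single_in_mag_deg) simp
  have A: "plext d3 p \<in> mag_deg 2" for p unfolding plext_d3 by (rule tree2_mag_deg)
  \<comment> \<open>Well-definedness on F^3: \<open>cubic\<close> sends the ideal into
    \<open>srel\<close>, and \<open>tree2\<close> sends \<open>srel\<close> back into the
    ideal.\<close>
  have K: "plext d3 p \<in> lie_ideal scale \<inter> mag_deg 2" if "p \<in> lie_ideal scale \<inter> mag_deg 3" for p
    using that A[of p] tree2_srel lie_ideal_maps unfolding plext_d3 by blast
  obtain D where D: "vlinear (free_lie_deg scale 3) (free_lie_deg scale 2) D"
      "\<And>p. p \<in> mag_deg 3 \<Longrightarrow> D (cls p) = cls (plext d3 p)"
    using presentation.vlinear_lift[OF presentation_free_lie_deg presentation_free_lie_deg A K]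
    by blast
  have "D (nest scale xs) = lie_diff_rhs scale lbr 2 xs" if len: "length xs = 3" for xs
  proof -
    obtain x y z where "xs = [x, y, z]"
      using len by (auto simp: numeral_3_eq_3 length_Suc_conv)
    then show ?thesis using D(2)[OF u[of x y z]] by (simp only: nest3 rhs3)
  qed
  note spec = lie_diff_spec[OF _ _ D(1) this, simplified]
  let ?S = "{p \<in> mag_deg 3. lie_diff scale lbr 3 (cls p) = cls (plext d3 p)}"
  have S: "pm.subspace ?S"
    by (rule subspace_vlinear_agree[OF spec(1) tree2_mag_deg])
  have uS: "?u x y z \<in> ?S" for x y z
    using spec(2)[of "[x, y, z]"] u unfolding nest3 rhs3 by simp
  have "p \<in> ?S"
  proof (rule mag_deg_induct[OF assms S])
    fix t :: "'g mag" assume t: "mag_len t = 3"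
    then obtain x y z where
      "t = Br (Gen x) (Br (Gen y) (Gen z)) \<or> t = Br (Br (Gen y) (Gen z)) (Gen x)"
      unfolding mag_len_eq_3 by blast
    then show "Poly_Mapping.single t 1 \<in> ?S"
    proof
      assume t': "t = Br (Br (Gen y) (Gen z)) (Gen x)"
      \<comment> \<open>The specification covers right-nested brackets only. Antisymmetry for
        lengths 2 and 1 replaces the left-nested tree by minus a right-nested one, and
        \<open>d3\<close> changes sign accordingly.\<close>
      have "Poly_Mapping.single t 1 - (- 1) \<odot> ?u x y z \<in> lie_ideal scale"
        using lie_ideal.antisym[of "Br (Gen y) (Gen z)" "Gen x" scale] by (simp add: t' single_uminus)
      then have c: "cls (Poly_Mapping.single t 1) = cls ((- 1) \<odot> ?u x y z)"
        using FL.eq_iff by blast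
      have e: "plext d3 (Poly_Mapping.single t 1) = plext d3 ((- 1) \<odot> ?u x y z)"
        by (simp add: t')
      have "(- 1) \<odot> ?u x y z \<in> ?S" by (rule pm.subspace_scale[OF S uS])
      then show ?thesis unfolding mem_Collect_eq c e using single_in_mag_deg[OF t] by blast
    qed (use uS in simp)
  qed
  then show ?thesis by simp
qed

text \<open>The full preimage of the boundaries among sums of two-leaf trees. Working modulo the
  ideal instead of taking the plain image of \<open>d3\<close> ensures
  \<open>lie_ideal_brel\<close>.\<close>

definition brel :: "('g mag \<Rightarrow>\<^sub>0 'k) set" where
  "brel = {q \<in> mag_deg 2. \<exists>p\<in>mag_deg 3. q - plext d3 p \<in> lie_ideal scale}"

lemma subspace_brel: "pm.subspace brel"
proof (rule pm.subspaceI)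
  have "0 - plext d3 0 \<in> lie_ideal scale" by (simp add: lie_ideal.zero)
  then show "0 \<in> brel"
    unfolding brel_def using pm.subspace_0[OF subspace_mag_deg] by blast
next
  fix q q' assume "q \<in> brel" "q' \<in> brel"
  then obtain p p' where *: "p \<in> mag_deg 3" "q - plext d3 p \<in> lie_ideal scale"
    "p' \<in> mag_deg 3" "q' - plext d3 p' \<in> lie_ideal scale" "q \<in> mag_deg 2" "q' \<in> mag_deg 2"
    unfolding brel_def by blast
  then have "(q - plext d3 p) + (q' - plext d3 p') \<in> lie_ideal scale"
    by (intro lie_ideal.add)
  then have "q + q' - plext d3 (p + p') \<in> lie_ideal scale" by (simp add: algebra_simps)
  then show "q + q' \<in> brel"
    unfolding brel_def using * pm.subspace_add[OF subspace_mag_deg] by blast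
next
  fix c q assume "q \<in> brel"
  then obtain p where *: "p \<in> mag_deg 3" "q - plext d3 p \<in> lie_ideal scale" "q \<in> mag_deg 2"
    unfolding brel_def by blast
  then have "c \<odot> (q - plext d3 p) \<in> lie_ideal scale"
    by (intro lie_ideal.smult)
  then have "c \<odot> q - plext d3 (c \<odot> p) \<in> lie_ideal scale" by (simp add: pm.scale_right_diff_distrib)
  then show "c \<odot> q \<in> brel"
    unfolding brel_def using * pm.subspace_scale[OF subspace_mag_deg] by blast
qed

lemma lie_ideal_brel: "lie_ideal scale \<inter> mag_deg 2 \<subseteq> brel"
proof
  fix q assume q: "q \<in> lie_ideal scale \<inter> mag_deg 2"
  then have "q - plext d3 0 \<in> lie_ideal scale" by simp
  then show "q \<in> brel"
    unfolding brel_def using q pm.subspace_0[OF subspace_mag_deg] by blast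
qed

section \<open>Degree-two homology and its comparison with \<open>Omega0\<close>\<close>

lemma lie_cycles_2: "lie_cycles scale lbr 2 = cls ` mag_deg 2"
  using lie_diff_2 presentation.carrier_eq[OF presentation_free_lie_deg, of scale 2]
  by (auto simp: lie_cycles_def FL.zero_eq)

lemma lie_boundaries_2: "lie_boundaries scale lbr 2 = cls ` brel"
proof -
  have "lie_boundaries scale lbr 2 = (\<lambda>p. cls (plext d3 p)) ` mag_deg 3"
    using lie_diff_3 presentation.carrier_eq[OF presentation_free_lie_deg, of scale 3]
    by (simp add: lie_boundaries_def image_image cong: image_cong)
  also have "\<dots> = cls ` brel"
  proof (intro equalityI image_subsetI)
    fix p :: "'g mag \<Rightarrow>\<^sub>0 'k" assume "p \<in> mag_deg 3"
    then have "plext d3 p \<in> brel"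
      unfolding brel_def using tree2_mag_deg[of "plext cubic p"] lie_ideal.zero[of scale]
      by (auto simp: plext_d3[symmetric] intro!: bexI[of _ p])
    then show "cls (plext d3 p) \<in> cls ` brel" by blast
  next
    fix q assume "q \<in> brel"
    then obtain p where "p \<in> mag_deg 3" "q - plext d3 p \<in> lie_ideal scale"
      unfolding brel_def by blast
    then show "cls q \<in> (\<lambda>p. cls (plext d3 p)) ` mag_deg 3" using FL.eq_iff by blast
  qed
  finally show ?thesis .
qed

lemma presentation_lie_homology_2:
  "presentation (lie_homology scale lbr 2) (\<lambda>p. homology_class scale lbr 2 (cls p)) (mag_deg 2) brel"
  unfolding lie_homology_def homology_class_def lie_cycles_2 lie_boundaries_2
  by (rule presentation.presentation_vquot[OF FL.presentation_vrestrict[OF subspace_mag_deg]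
        subspace_brel lie_ideal_brel]) (auto simp: brel_def)

lemma tree2_orel:
  assumes "q \<in> orel"
  shows "plext tree2 q \<in> brel"
proof (rule plext_span[OF _ subspace_brel assms[unfolded orel_def]])
  have I: "plext tree2 s \<in> brel" if "plext tree2 s \<in> lie_ideal scale" for s
    using that tree2_mag_deg lie_ideal_brel by blast
  have inv: "plext tree2 (tens (lbr x y) z - tens x (lbr y z)) \<in> brel" for x y z
  proof -
    \<comment> \<open>The witness is -{y, x, z}: its \<open>d3\<close> is the image of -[y, x] z - x
      [y, z]. Subtracting it cancels x [y, z] and leaves only antisymmetry of the bracket in the
      first factor.\<close>
    let ?r = "(- 1) \<odot> Poly_Mapping.single (Br (Gen y) (Br (Gen x) (Gen z))) (1 :: 'k)"
    have "plext tree2 (tens (lbr x y) z - tens x (lbr y z)) - plext d3 ?r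
        = plext tree2 (tens (lbr x y) z + tens (lbr y x) z)"
      by (simp add: algebra_simps)
    also have "\<dots> \<in> lie_ideal scale" by (rule tree2_trel[OF tens_neg_left])
    finally have "plext tree2 (tens (lbr x y) z - tens x (lbr y z)) - plext d3 ?r \<in> lie_ideal scale" .
    moreover have "?r \<in> mag_deg 3"
      by (intro pm.subspace_scale[OF subspace_mag_deg] single_in_mag_deg) simp
    ultimately show ?thesis unfolding brel_def using tree2_mag_deg by blast
  qed
  show "plext tree2 s \<in> brel"
    if "s \<in> {tens x y - tens y x |x y. True} \<union> {tens (lbr x y) z - tens x (lbr y z) |x y z. True} \<union> trel" for s
    using that I[OF tree2_sym] I[OF tree2_trel] inv by blast
qed

lemma quad_orel_iff:
  assumes "p \<in> mag_deg 2"
  shows "plext quad p \<in> orel \<longleftrightarrow> p \<in> brel"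
proof
  assume "plext quad p \<in> orel"
  then show "p \<in> brel" using tree2_orel tree2_quad[OF assms] by metis
next
  assume "p \<in> brel"
  then obtain r where r: "p - plext d3 r \<in> lie_ideal scale" unfolding brel_def by blast
  then have "plext quad (p - plext d3 r) \<in> orel" using lie_ideal_maps srel_orel by blast
  \<comment> \<open>\<open>quad\<close> undoes the \<open>tree2\<close> in \<open>d3\<close>,
    leaving the cubic part of \<open>r\<close>, a sum of derivation actions.\<close>
  moreover have "plext quad (plext d3 r) \<in> orel"
    unfolding plext_d3 quad_tree2 by (rule pm.lext_mem[OF subspace_orel cubic_orel])
  ultimately have "plext quad (p - plext d3 r) + plext quad (plext d3 r) \<in> orel"
    by (rule pm.subspace_add[OF subspace_orel])
  then show "plext quad p \<in> orel" by (simp only: pm.lext_diff diff_add_cancel)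
qed

lemma lie_homology_2_iso_Omega0:
  "\<exists>f \<phi>.
    vlinear (free_lie_deg scale 2) (Omega0 scale lbr) f \<and>
    (\<forall>x y. f (fl_br scale (fl_gen scale x) (fl_gen scale y))
            = Omega0_class scale lbr (tensor scale x y)) \<and>
    viso (lie_homology scale lbr 2) (Omega0 scale lbr) \<phi> \<and>
    (\<forall>u \<in> lie_cycles scale lbr 2. \<phi> (homology_class scale lbr 2 u) = f u)"
proof -
  let ?\<rho> = "\<lambda>p. Omega0_class scale lbr (vcoset free_vspace trel p)"
  obtain f where f: "vlinear (free_lie_deg scale 2) (Omega0 scale lbr) f"
      "\<And>p. p \<in> mag_deg 2 \<Longrightarrow> f (cls p) = ?\<rho> (plext quad p)"
  proof (rule presentation.vlinear_lift[OF presentation_free_lie_deg presentation_Omega0, of 2 quad])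
    show "plext quad p \<in> orel" if "p \<in> lie_ideal scale \<inter> mag_deg 2" for p
      using that lie_ideal_maps srel_orel by blast
  qed auto
  \<comment> \<open>The same map \<open>quad\<close> induces \<open>f\<close> on F^2 and \<phi> on
    homology, so the two agree on cycles by construction.\<close>
  obtain \<phi> where \<phi>: "viso (lie_homology scale lbr 2) (Omega0 scale lbr) \<phi>"
      "\<And>p. p \<in> mag_deg 2 \<Longrightarrow> \<phi> (homology_class scale lbr 2 (cls p)) = ?\<rho> (plext quad p)"
  proof (rule presentation.viso_lift[OF presentation_lie_homology_2 presentation_Omega0, of quad])
    show "plext quad p \<in> orel \<longleftrightarrow> p \<in> brel" if "p \<in> mag_deg 2" for p
      using that by (rule quad_orel_iff)
    show "\<exists>p\<in>mag_deg 2. plext quad p = q" for q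
      using quad_tree2 tree2_mag_deg by blast
  qed auto
  have "f (fl_br scale (fl_gen scale x) (fl_gen scale y)) = Omega0_class scale lbr (tensor scale x y)"
    for x y
    using f(2)[OF tree2_mag_deg[of "tens x y"]] nest2[of x y]
    by (simp add: tensor_def del: pm.lext_single)
  moreover have "\<forall>u\<in>lie_cycles scale lbr 2. \<phi> (homology_class scale lbr 2 u) = f u"
    using f(2) \<phi>(2) unfolding lie_cycles_2 by simp
  ultimately show ?thesis using f(1) \<phi>(1) by blast
qed

end

theorem proposition3p6:
  fixes scale :: "'k::field_char_0 \<Rightarrow> 'g::ab_group_add \<Rightarrow> 'g"
    and lbr :: "'g \<Rightarrow> 'g \<Rightarrow> 'g"
  assumes "lie_algebra scale lbr"
  shows "\<exists>f \<phi>.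
    vlinear (free_lie_deg scale 2) (Omega0 scale lbr) f \<and>
    (\<forall>x y. f (fl_br scale (fl_gen scale x) (fl_gen scale y))
            = Omega0_class scale lbr (tensor scale x y)) \<and>
    viso (lie_homology scale lbr 2) (Omega0 scale lbr) \<phi> \<and>
    (\<forall>u \<in> lie_cycles scale lbr 2. \<phi> (homology_class scale lbr 2 u) = f u)"
  using assms by (rule lie_algebra.lie_homology_2_iso_Omega0)

end
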